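(* Let $R$ be a ring, $M$ a nonzero uniformly finite $R$-module and $N$ a submodule of $M$ with $N\neq M$. Then $N$ admits a primary decomposition in $M$, i.e. $N=N_1\cap\cdots\cap N_s$ for some primary submodules $N_1,\ldots,N_s$ of $M$. Moreover, for any primary decomposition $N=N_1\cap\cdots\cap N_s$ with $\operatorname{As}_R(M/N_i)=\{X_i\}$: 1. $\operatorname{As}_R(M/N)\subseteq \bigcup_{i=1}^s\operatorname{As}_R(M/N_i)=\{X_1,\ldots,X_s\}$. 2. If the intersection is irredundant, then $\operatorname{As}_R(M/N)=\bigcup_{i=1}^s\operatorname{As}_R(M/N_i)$. 3. If the intersection is shortest, then each associated left prime of $M/N$ (i.e. each element of $\operatorname{As}_R(M/N)$) is equal to $X_i$ for exactly one index $i$. 4. Let $N=L_1\cap\cdots\cap L_r$ be a primary decomposition of $N$ in $M$. Then it is shortest if and only if $r=|\operatorname{As}_R(M/N)|$.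
   Context: Rings have $1$ and need not be commutative; module means left module. A submodule $N$ of $M$ is essential if $N\cap L\neq 0$ for every nonzero submodule $L$ of $M$. A module $U$ is uniform if $U\neq 0$ and every nonzero submodule of $U$ is essential in $U$. A module has finite uniform dimension if it contains no infinite direct sum of nonzero submodules; then $\operatorname{u.dim}(M)$ is the number of summands in any essential direct sum of uniform submodules of $M$ ($0$ if $M=0$). Modules $M_1,M_2$ are essentially equivalent if there are essential submodules $L_1\subseteq M_1$, $L_2\subseteq M_2$ with $L_1\simeq L_2$; $[M]$ denotes the equivalence class of $M$. A left prime of $R$ is the class $[U]$ of a uniform $R$-module $U$. For a module $M$ of finite uniform dimension, $\operatorname{As}_R(M)=\{[U] : U \text{ is a uniform submodule of } M\}$ is the set of associated left primes of $M$. An $R$-module $M$ is uniformly finite if every factor module of $M$ has finite uniform dimension. A submodule $N$ of $M$ is primary if $\operatorname{u.dim}(M/N)<\infty$ and $\operatorname{As}_R(M/N)$ consists of a single element $X$ (then $N$ is called $X$-primary). A primary decomposition of $N$ in $M$ is an expression $N=N_1\cap\cdots\cap N_s$ ($s\ge 1$ finite) with each $N_i$ a primary submodule of $M$. It is irredundant if no $N_i$ can be dropped without changing the intersection, and shortest if there is no primary decomposition of $N$ in $M$ with fewer terms. *)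

theory Defs
  imports "HOL-Algebra.Module" "HOL-Algebra.QuotRing"
begin

text \<open>
  The library locale \<^locale>\<open>module\<close> requires a commutative ring of scalars, so left modules over
  an arbitrary ring with \<open>1\<close> are introduced here with the same axioms over \<^locale>\<open>ring\<close>.  As in the
  library, the fields \<open>mult\<close> and \<open>one\<close> of the record type of modules carry no information.
  The library predicate \<^term>\<open>submodule\<close> does not involve commutativity and is used as it is;
  a submodule \<open>N\<close> of \<open>M\<close>, viewed as a module, is \<^term>\<open>M\<lparr>carrier := N\<rparr>\<close>.
\<close>

locale left_module = R?: ring R + M?: abelian_group M
  for R :: "('r, 'k) ring_scheme" (structure) and M :: "('r, 'a, 'm) module_scheme" (structure) +
  assumes smult_closed [simp, intro]:
      "\<lbrakk>a \<in> carrier R; x \<in> carrier M\<rbrakk> \<Longrightarrow> a \<odot>\<^bsub>M\<^esub> x \<in> carrier M"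
    and smult_l_distr:
      "\<lbrakk>a \<in> carrier R; b \<in> carrier R; x \<in> carrier M\<rbrakk> \<Longrightarrow>
        (a \<oplus> b) \<odot>\<^bsub>M\<^esub> x = a \<odot>\<^bsub>M\<^esub> x \<oplus>\<^bsub>M\<^esub> b \<odot>\<^bsub>M\<^esub> x"
    and smult_r_distr:
      "\<lbrakk>a \<in> carrier R; x \<in> carrier M; y \<in> carrier M\<rbrakk> \<Longrightarrow>
        a \<odot>\<^bsub>M\<^esub> (x \<oplus>\<^bsub>M\<^esub> y) = a \<odot>\<^bsub>M\<^esub> x \<oplus>\<^bsub>M\<^esub> a \<odot>\<^bsub>M\<^esub> y"
    and smult_assoc1:
      "\<lbrakk>a \<in> carrier R; b \<in> carrier R; x \<in> carrier M\<rbrakk> \<Longrightarrow>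
        (a \<otimes> b) \<odot>\<^bsub>M\<^esub> x = a \<odot>\<^bsub>M\<^esub> (b \<odot>\<^bsub>M\<^esub> x)"
    and smult_one [simp]:
      "x \<in> carrier M \<Longrightarrow> \<one> \<odot>\<^bsub>M\<^esub> x = x"

definition nonzero_submodule ::
    "('r, 'k) ring_scheme \<Rightarrow> ('r, 'a, 'm) module_scheme \<Rightarrow> 'a set \<Rightarrow> bool" where
  "nonzero_submodule R M L \<longleftrightarrow> submodule L R M \<and> L \<noteq> {\<zero>\<^bsub>M\<^esub>}"

text \<open>
  The factor module \<open>M/N\<close> on the cosets of \<open>N\<close>.  Scalar multiplication is \<open>a (N + x) = N + a x\<close>,
  written as a union over representatives in the same way as \<^const>\<open>rcoset_mult\<close>.
\<close>

definition factor_module ::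
    "('r, 'a, 'm) module_scheme \<Rightarrow> 'a set \<Rightarrow> ('r, 'a set) module" where
  "factor_module M N =
    \<lparr>carrier = a_rcosets\<^bsub>M\<^esub> N, mult = undefined, one = undefined,
     zero = N, add = set_add M,
     smult = (\<lambda>a A. \<Union>x\<in>A. N +>\<^bsub>M\<^esub> (a \<odot>\<^bsub>M\<^esub> x))\<rparr>"

definition essential_submodule ::
    "('r, 'k) ring_scheme \<Rightarrow> ('r, 'a, 'm) module_scheme \<Rightarrow> 'a set \<Rightarrow> bool" where
  "essential_submodule R M N \<longleftrightarrow>
    submodule N R M \<and> (\<forall>L. nonzero_submodule R M L \<longrightarrow> N \<inter> L \<noteq> {\<zero>\<^bsub>M\<^esub>})"

definition uniform_module ::
    "('r, 'k) ring_scheme \<Rightarrow> ('r, 'a, 'm) module_scheme \<Rightarrow> bool" where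
  "uniform_module R U \<longleftrightarrow>
    left_module R U \<and> carrier U \<noteq> {\<zero>\<^bsub>U\<^esub>} \<and>
    (\<forall>L. nonzero_submodule R U L \<longrightarrow> essential_submodule R U L)"

text \<open>The sum of the family \<open>(L i)\<close>, \<open>i \<in> I\<close>, of submodules of \<open>M\<close> is direct.\<close>

definition direct_sum_family ::
    "('r, 'a, 'm) module_scheme \<Rightarrow> 'i set \<Rightarrow> ('i \<Rightarrow> 'a set) \<Rightarrow> bool" where
  "direct_sum_family M I L \<longleftrightarrow>
    (\<forall>F x. finite F \<and> F \<subseteq> I \<and> (\<forall>i\<in>F. x i \<in> L i) \<and> (\<Oplus>\<^bsub>M\<^esub>i\<in>F. x i) = \<zero>\<^bsub>M\<^esub>
      \<longrightarrow> (\<forall>i\<in>F. x i = \<zero>\<^bsub>M\<^esub>))"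

text \<open>
  The members of a direct family of nonzero submodules are pairwise distinct, so such a family can be
  indexed by the set of its members.
\<close>

definition finite_uniform_dim ::
    "('r, 'k) ring_scheme \<Rightarrow> ('r, 'a, 'm) module_scheme \<Rightarrow> bool" where
  "finite_uniform_dim R M \<longleftrightarrow>
    \<not> (\<exists>S. infinite S \<and> (\<forall>L\<in>S. nonzero_submodule R M L) \<and> direct_sum_family M S (\<lambda>L. L))"

definition uniformly_finite ::
    "('r, 'k) ring_scheme \<Rightarrow> ('r, 'a, 'm) module_scheme \<Rightarrow> bool" where
  "uniformly_finite R M \<longleftrightarrow>
    (\<forall>N. submodule N R M \<longrightarrow> finite_uniform_dim R (factor_module M N))"

definition left_module_iso ::
    "('r, 'k) ring_scheme \<Rightarrow> ('r, 'a, 'm) module_scheme \<Rightarrow> ('r, 'b, 'n) module_scheme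
      \<Rightarrow> ('a \<Rightarrow> 'b) set" where
  "left_module_iso R M M' =
    {f \<in> iso (add_monoid M) (add_monoid M').
      \<forall>a\<in>carrier R. \<forall>x\<in>carrier M. f (a \<odot>\<^bsub>M\<^esub> x) = a \<odot>\<^bsub>M'\<^esub> f x}"

definition essentially_equivalent ::
    "('r, 'k) ring_scheme \<Rightarrow> ('r, 'a, 'm) module_scheme \<Rightarrow> ('r, 'b, 'n) module_scheme
      \<Rightarrow> bool" where
  "essentially_equivalent R M\<^sub>1 M\<^sub>2 \<longleftrightarrow>
    (\<exists>L\<^sub>1 L\<^sub>2. essential_submodule R M\<^sub>1 L\<^sub>1 \<and> essential_submodule R M\<^sub>2 L\<^sub>2 \<and>
      left_module_iso R (M\<^sub>1\<lparr>carrier := L\<^sub>1\<rparr>) (M\<^sub>2\<lparr>carrier := L\<^sub>2\<rparr>) \<noteq> {})"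

text \<open>
  The class \<open>[M]\<close> is taken among the \<open>R\<close>-modules whose elements lie in the same type as those of \<open>M\<close>,
  since HOL has no type of all \<open>R\<close>-modules.  As essential equivalence is an equivalence relation, two
  modules on this type have the same class if and only if they are essentially equivalent.  All factor
  modules of one module have their elements in one type, so their associated left primes are comparable.
\<close>

definition essential_class ::
    "('r, 'k) ring_scheme \<Rightarrow> ('r, 'a) module \<Rightarrow> ('r, 'a) module set" where
  "essential_class R M = {M'. left_module R M' \<and> essentially_equivalent R M M'}"

definition associated_left_primes ::
    "('r, 'k) ring_scheme \<Rightarrow> ('r, 'a) module \<Rightarrow> ('r, 'a) module set set" where
  "associated_left_primes R M =
    {essential_class R (M\<lparr>carrier := U\<rparr>) | U.
      submodule U R M \<and> uniform_module R (M\<lparr>carrier := U\<rparr>)}"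

definition primary_submodule ::
    "('r, 'k) ring_scheme \<Rightarrow> ('r, 'a, 'm) module_scheme \<Rightarrow> 'a set \<Rightarrow> bool" where
  "primary_submodule R M N \<longleftrightarrow>
    submodule N R M \<and> finite_uniform_dim R (factor_module M N) \<and>
    (\<exists>X. associated_left_primes R (factor_module M N) = {X})"

definition primary_decomposition ::
    "('r, 'k) ring_scheme \<Rightarrow> ('r, 'a, 'm) module_scheme \<Rightarrow> 'a set
      \<Rightarrow> nat \<Rightarrow> (nat \<Rightarrow> 'a set) \<Rightarrow> bool" where
  "primary_decomposition R M N s P \<longleftrightarrow>
    s \<ge> 1 \<and> (\<forall>i\<in>{1..s}. primary_submodule R M (P i)) \<and> N = (\<Inter>i\<in>{1..s}. P i)"

text \<open>Intersecting with \<^term>\<open>carrier M\<close> makes the empty intersection (case \<open>s = 1\<close>) equal to \<open>M\<close>.\<close>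

definition irredundant_intersection ::
    "('r, 'a, 'm) module_scheme \<Rightarrow> nat \<Rightarrow> (nat \<Rightarrow> 'a set) \<Rightarrow> bool" where
  "irredundant_intersection M s P \<longleftrightarrow>
    (\<forall>i\<in>{1..s}. carrier M \<inter> (\<Inter>j\<in>{1..s} - {i}. P j) \<noteq> carrier M \<inter> (\<Inter>j\<in>{1..s}. P j))"

definition shortest_primary_decomposition ::
    "('r, 'k) ring_scheme \<Rightarrow> ('r, 'a, 'm) module_scheme \<Rightarrow> 'a set
      \<Rightarrow> nat \<Rightarrow> (nat \<Rightarrow> 'a set) \<Rightarrow> bool" where
  "shortest_primary_decomposition R M N s P \<longleftrightarrow>
    primary_decomposition R M N s P \<and>
    \<not> (\<exists>t Q. t < s \<and> primary_decomposition R M N t Q)"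

end

theory Submission
  imports Defs
begin

text \<open>
  Essential and uniform submodules are handled elementwise: \<open>U\<close> is uniform iff any two nonzero elements
  have a common nonzero multiple.  Suppose \<open>N = P\<^sub>1 \<inter> \<dots> \<inter> P\<^sub>s\<close>.  A uniform submodule of \<open>M/N\<close> meets some
  kernel \<open>P\<^sub>i/N\<close> trivially, since the \<open>P\<^sub>i/N\<close> intersect in \<open>0\<close>; hence it embeds into \<open>M/P\<^sub>i\<close>.  If \<open>P\<^sub>i\<close> cannot be
  dropped, the intersection \<open>K\<close> of the others gives a nonzero submodule \<open>K/N\<close> of \<open>M/P\<^sub>i\<close>, and a uniform
  submodule of \<open>K/N\<close> realises \<open>X\<^sub>i\<close> in \<open>M/N\<close>.  In a shortest decomposition nothing can be dropped and
  the \<open>X\<^sub>i\<close> are distinct, because the intersection of two \<open>X\<close>-primary submodules is \<open>X\<close>-primary.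

  For existence put \<open>K\<^sub>0 = M\<close>.  While \<open>K\<^sub>n \<noteq> N\<close>, choose a submodule \<open>U\<^sub>n \<subseteq> K\<^sub>n\<close> with \<open>U\<^sub>n/N\<close> uniform and a
  submodule \<open>P\<^sub>n\<close> maximal with \<open>P\<^sub>n \<inter> U\<^sub>n = N\<close>, and set \<open>K\<^bsub>n+1\<^esub> = K\<^sub>n \<inter> P\<^sub>n\<close>.  Then \<open>M/P\<^sub>n\<close> is uniform, so
  \<open>P\<^sub>n\<close> is primary, and the sum of the \<open>U\<^sub>n/N\<close> is direct, so the construction stops.
\<close>

subsection \<open>Left modules and submodules\<close>

context left_module
begin

lemma smult_r_null [simp]: "a \<in> carrier R \<Longrightarrow> a \<odot>\<^bsub>M\<^esub> \<zero>\<^bsub>M\<^esub> = \<zero>\<^bsub>M\<^esub>"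
  by (metis M.add.l_cancel_one M.l_zero M.zero_closed smult_closed smult_r_distr)

lemma smult_l_null [simp]: "x \<in> carrier M \<Longrightarrow> \<zero> \<odot>\<^bsub>M\<^esub> x = \<zero>\<^bsub>M\<^esub>"
  by (metis M.add.l_cancel_one R.l_zero R.zero_closed smult_closed smult_l_distr)

lemma smult_l_minus: "\<lbrakk>a \<in> carrier R; x \<in> carrier M\<rbrakk> \<Longrightarrow> (\<ominus> a) \<odot>\<^bsub>M\<^esub> x = \<ominus>\<^bsub>M\<^esub> (a \<odot>\<^bsub>M\<^esub> x)"
  by (metis M.minus_equality R.add.inv_closed R.l_neg smult_closed smult_l_distr smult_l_null)

lemma smult_minus_one: "x \<in> carrier M \<Longrightarrow> (\<ominus> \<one>) \<odot>\<^bsub>M\<^esub> x = \<ominus>\<^bsub>M\<^esub> x"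
  by (simp add: smult_l_minus)

text \<open>Negatives come from scalars: the negative of \<open>x\<close> is its multiple by
  \<open>\<ominus> \<one>\<close>, so closure under sums and multiples gives a subgroup.\<close>

lemma submoduleI:
  assumes "H \<subseteq> carrier M" "\<zero>\<^bsub>M\<^esub> \<in> H"
    and "\<And>x y. \<lbrakk>x \<in> H; y \<in> H\<rbrakk> \<Longrightarrow> x \<oplus>\<^bsub>M\<^esub> y \<in> H"
    and "\<And>a x. \<lbrakk>a \<in> carrier R; x \<in> H\<rbrakk> \<Longrightarrow> a \<odot>\<^bsub>M\<^esub> x \<in> H"
  shows "submodule H R M"
proof -
  have "\<ominus>\<^bsub>M\<^esub> x \<in> H" if "x \<in> H" for x
    using assms(4)[of "\<ominus> \<one>" x] that assms(1) smult_minus_one by auto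
  then show ?thesis
    by (intro submodule.intro subgroup.intro submodule_axioms.intro)
      (use assms in \<open>simp_all flip: a_inv_def\<close>)
qed

lemma submoduleD:
  assumes "submodule H R M"
  shows "x \<in> H \<Longrightarrow> x \<in> carrier M" "\<zero>\<^bsub>M\<^esub> \<in> H"
    "\<lbrakk>x \<in> H; y \<in> H\<rbrakk> \<Longrightarrow> x \<oplus>\<^bsub>M\<^esub> y \<in> H"
    "\<lbrakk>a \<in> carrier R; x \<in> H\<rbrakk> \<Longrightarrow> a \<odot>\<^bsub>M\<^esub> x \<in> H"
    "x \<in> H \<Longrightarrow> \<ominus>\<^bsub>M\<^esub> x \<in> H"
proof -
  interpret submodule H R M by fact
  show "x \<in> H \<Longrightarrow> x \<in> carrier M" "\<zero>\<^bsub>M\<^esub> \<in> H"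
    "\<lbrakk>x \<in> H; y \<in> H\<rbrakk> \<Longrightarrow> x \<oplus>\<^bsub>M\<^esub> y \<in> H"
    "\<lbrakk>a \<in> carrier R; x \<in> H\<rbrakk> \<Longrightarrow> a \<odot>\<^bsub>M\<^esub> x \<in> H"
    using subset m_closed one_closed by auto
  show "x \<in> H \<Longrightarrow> \<ominus>\<^bsub>M\<^esub> x \<in> H"
    using m_inv_closed by (simp add: a_inv_def)
qed

lemma submodule_carrier: "submodule (carrier M) R M"
  by (rule submoduleI) auto

lemma submodule_Int: "\<lbrakk>submodule H R M; submodule K R M\<rbrakk> \<Longrightarrow> submodule (H \<inter> K) R M"
  by (rule submoduleI) (auto dest: submoduleD)

lemma submodule_INT:
  assumes "I \<noteq> {}" "\<And>i. i \<in> I \<Longrightarrow> submodule (H i) R M"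
  shows "submodule (\<Inter>i\<in>I. H i) R M"
  by (rule submoduleI) (use assms in \<open>auto dest: submoduleD\<close>)

lemma submodule_cyclic:
  assumes "x \<in> carrier M"
  shows "submodule {a \<odot>\<^bsub>M\<^esub> x | a. a \<in> carrier R} R M"
proof (rule submoduleI)
  show "\<zero>\<^bsub>M\<^esub> \<in> {a \<odot>\<^bsub>M\<^esub> x | a. a \<in> carrier R}"
    using assms smult_l_null by (metis (mono_tags, lifting) R.zero_closed mem_Collect_eq)
next
  fix y z assume "y \<in> {a \<odot>\<^bsub>M\<^esub> x | a. a \<in> carrier R}" "z \<in> {a \<odot>\<^bsub>M\<^esub> x | a. a \<in> carrier R}"
  then show "y \<oplus>\<^bsub>M\<^esub> z \<in> {a \<odot>\<^bsub>M\<^esub> x | a. a \<in> carrier R}"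
    using assms by clarify (metis R.add.m_closed smult_l_distr)
next
  fix b y assume "b \<in> carrier R" "y \<in> {a \<odot>\<^bsub>M\<^esub> x | a. a \<in> carrier R}"
  then show "b \<odot>\<^bsub>M\<^esub> y \<in> {a \<odot>\<^bsub>M\<^esub> x | a. a \<in> carrier R}"
    using assms by clarify (metis R.m_closed smult_assoc1)
qed (use assms in auto)

lemma cyclic_self: "x \<in> carrier M \<Longrightarrow> x \<in> {a \<odot>\<^bsub>M\<^esub> x | a. a \<in> carrier R}"
  by (metis (mono_tags, lifting) R.one_closed mem_Collect_eq smult_one)

text \<open>This is P + Rx, the smallest enlargement of P containing x; maximality of a complement
  is later tested on it.\<close>

lemma submodule_add_cyclic:
  assumes P: "submodule P R M" and x: "x \<in> carrier M"
  shows "submodule {p \<oplus>\<^bsub>M\<^esub> a \<odot>\<^bsub>M\<^esub> x | p a. p \<in> P \<and> a \<in> carrier R} R M" (is "submodule ?H R M")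
proof (rule submoduleI)
  note PD = submoduleD[OF P]
  show "?H \<subseteq> carrier M"
    using PD(1) x by auto
  show "\<zero>\<^bsub>M\<^esub> \<in> ?H"
    using PD(2) x by (intro CollectI exI[of _ "\<zero>\<^bsub>M\<^esub>"] exI[of _ "\<zero>"]) auto
next
  note PD = submoduleD[OF P]
  fix y z assume "y \<in> ?H" "z \<in> ?H"
  then obtain p a q b where *: "p \<in> P" "a \<in> carrier R" "y = p \<oplus>\<^bsub>M\<^esub> a \<odot>\<^bsub>M\<^esub> x"
    "q \<in> P" "b \<in> carrier R" "z = q \<oplus>\<^bsub>M\<^esub> b \<odot>\<^bsub>M\<^esub> x"
    by blast
  then have "y \<oplus>\<^bsub>M\<^esub> z = (p \<oplus>\<^bsub>M\<^esub> q) \<oplus>\<^bsub>M\<^esub> (a \<oplus> b) \<odot>\<^bsub>M\<^esub> x"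
    using PD(1) x by (simp add: smult_l_distr M.a_ac)
  then show "y \<oplus>\<^bsub>M\<^esub> z \<in> ?H"
    using * PD(3) by blast
next
  note PD = submoduleD[OF P]
  fix b y assume "b \<in> carrier R" "y \<in> ?H"
  then obtain p a where *: "p \<in> P" "a \<in> carrier R" "y = p \<oplus>\<^bsub>M\<^esub> a \<odot>\<^bsub>M\<^esub> x"
    by blast
  then have "b \<odot>\<^bsub>M\<^esub> y = b \<odot>\<^bsub>M\<^esub> p \<oplus>\<^bsub>M\<^esub> (b \<otimes> a) \<odot>\<^bsub>M\<^esub> x"
    using \<open>b \<in> carrier R\<close> PD(1) x by (simp add: smult_r_distr smult_assoc1)
  then show "b \<odot>\<^bsub>M\<^esub> y \<in> ?H"
    using * PD(4) \<open>b \<in> carrier R\<close> by blast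
qed

lemma left_module_submodule:
  assumes "submodule H R M"
  shows "left_module R (M\<lparr>carrier := H\<rparr>)"
proof -
  note HD = submoduleD[OF assms]
  have "abelian_group (M\<lparr>carrier := H\<rparr>)"
  proof (rule abelian_groupI)
    fix x assume "x \<in> carrier (M\<lparr>carrier := H\<rparr>)"
    then show "\<exists>y\<in>carrier (M\<lparr>carrier := H\<rparr>). y \<oplus>\<^bsub>M\<lparr>carrier := H\<rparr>\<^esub> x = \<zero>\<^bsub>M\<lparr>carrier := H\<rparr>\<^esub>"
      using HD M.l_neg by (auto intro!: bexI[of _ "\<ominus>\<^bsub>M\<^esub> x"])
  qed (use HD in \<open>auto simp: M.a_ac\<close>)
  then show ?thesis
    by (intro left_module.intro left_module_axioms.intro R.ring_axioms)
      (use HD in \<open>auto simp: smult_l_distr smult_r_distr smult_assoc1\<close>)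
qed

lemma submodule_submodule_iff:
  assumes "submodule H R M"
  shows "submodule L R (M\<lparr>carrier := H\<rparr>) \<longleftrightarrow> submodule L R M \<and> L \<subseteq> H"
proof -
  interpret H: left_module R "M\<lparr>carrier := H\<rparr>"
    by (rule left_module_submodule[OF assms])
  show ?thesis
  proof (intro iffI conjI)
    assume *: "submodule L R (M\<lparr>carrier := H\<rparr>)"
    show "L \<subseteq> H"
      using H.submoduleD(1)[OF *] by auto
    then show "submodule L R M"
      by (intro submoduleI) (use H.submoduleD[OF *] submoduleD(1)[OF assms] in auto)
  next
    assume *: "submodule L R M \<and> L \<subseteq> H"
    show "submodule L R (M\<lparr>carrier := H\<rparr>)"
      by (rule H.submoduleI) (use submoduleD[of L] * in auto)
  qed
qed

section \<open>Elementwise criteria for essential and uniform\<close>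

text \<open>Every nonzero submodule contains a nonzero cyclic one, so it is enough to meet the
  cyclic submodules Rx.\<close>

lemma essential_submodule_iff:
  "essential_submodule R M N \<longleftrightarrow> submodule N R M \<and>
    (\<forall>x\<in>carrier M - {\<zero>\<^bsub>M\<^esub>}. \<exists>a\<in>carrier R. a \<odot>\<^bsub>M\<^esub> x \<in> N - {\<zero>\<^bsub>M\<^esub>})" (is "_ \<longleftrightarrow> ?r")
proof
  assume e: "essential_submodule R M N"
  then have N: "submodule N R M"
    by (simp add: essential_submodule_def)
  moreover have "\<exists>a\<in>carrier R. a \<odot>\<^bsub>M\<^esub> x \<in> N - {\<zero>\<^bsub>M\<^esub>}" if "x \<in> carrier M - {\<zero>\<^bsub>M\<^esub>}" for x
  proof -
    let ?L = "{a \<odot>\<^bsub>M\<^esub> x | a. a \<in> carrier R}"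
    have "nonzero_submodule R M ?L"
      unfolding nonzero_submodule_def using that submodule_cyclic[of x] cyclic_self[of x] by blast
    then have "N \<inter> ?L \<noteq> {\<zero>\<^bsub>M\<^esub>}"
      using e by (simp add: essential_submodule_def)
    moreover have "\<zero>\<^bsub>M\<^esub> \<in> N \<inter> ?L"
      using that submoduleD(2)[OF N] submoduleD(2)[OF submodule_cyclic[of x]] by blast
    ultimately show ?thesis
      by blast
  qed
  ultimately show ?r
    by blast
next
  assume r: ?r
  have "N \<inter> L \<noteq> {\<zero>\<^bsub>M\<^esub>}" if L: "nonzero_submodule R M L" for L
  proof -
    from L have LD: "submodule L R M"
      by (simp add: nonzero_submodule_def)
    obtain x where x: "x \<in> L" "x \<noteq> \<zero>\<^bsub>M\<^esub>"
      using L submoduleD(2)[OF LD] unfolding nonzero_submodule_def by blast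
    then obtain a where "a \<in> carrier R" "a \<odot>\<^bsub>M\<^esub> x \<in> N - {\<zero>\<^bsub>M\<^esub>}"
      using r submoduleD(1)[OF LD] by blast
    then show ?thesis
      using submoduleD(4)[OF LD] x by blast
  qed
  then show "essential_submodule R M N"
    using r by (simp add: essential_submodule_def)
qed

text \<open>Essentiality of the cyclic submodule Ry, tested at x, is exactly a common nonzero
  multiple of x and y. Conversely, a nonzero element y of L yields the multiples of each x that lie
  in L.\<close>

lemma uniform_module_iff:
  "uniform_module R M \<longleftrightarrow> carrier M \<noteq> {\<zero>\<^bsub>M\<^esub>} \<and>
    (\<forall>x\<in>carrier M - {\<zero>\<^bsub>M\<^esub>}. \<forall>y\<in>carrier M - {\<zero>\<^bsub>M\<^esub>}.
      \<exists>a\<in>carrier R. \<exists>b\<in>carrier R. a \<odot>\<^bsub>M\<^esub> x = b \<odot>\<^bsub>M\<^esub> y \<and> a \<odot>\<^bsub>M\<^esub> x \<noteq> \<zero>\<^bsub>M\<^esub>)" (is "_ \<longleftrightarrow> _ \<and> ?r")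
proof -
  have "(\<forall>L. nonzero_submodule R M L \<longrightarrow> essential_submodule R M L) \<longleftrightarrow> ?r"
  proof
    assume e: "\<forall>L. nonzero_submodule R M L \<longrightarrow> essential_submodule R M L"
    show ?r
    proof (intro ballI)
      fix x y assume x: "x \<in> carrier M - {\<zero>\<^bsub>M\<^esub>}" and y: "y \<in> carrier M - {\<zero>\<^bsub>M\<^esub>}"
      let ?L = "{a \<odot>\<^bsub>M\<^esub> y | a. a \<in> carrier R}"
      have "nonzero_submodule R M ?L"
        unfolding nonzero_submodule_def using y submodule_cyclic[of y] cyclic_self[of y] by blast
      then have "\<exists>a\<in>carrier R. a \<odot>\<^bsub>M\<^esub> x \<in> ?L - {\<zero>\<^bsub>M\<^esub>}"
        using e x by (simp only: essential_submodule_iff)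
      then show "\<exists>a\<in>carrier R. \<exists>b\<in>carrier R. a \<odot>\<^bsub>M\<^esub> x = b \<odot>\<^bsub>M\<^esub> y \<and> a \<odot>\<^bsub>M\<^esub> x \<noteq> \<zero>\<^bsub>M\<^esub>"
        by blast
    qed
  next
    assume r: ?r
    show "\<forall>L. nonzero_submodule R M L \<longrightarrow> essential_submodule R M L"
    proof (intro allI impI)
      fix L assume L: "nonzero_submodule R M L"
      then have LD: "submodule L R M"
        by (simp add: nonzero_submodule_def)
      obtain y where y: "y \<in> L" "y \<noteq> \<zero>\<^bsub>M\<^esub>"
        using L submoduleD(2)[OF LD] unfolding nonzero_submodule_def by blast
      have "\<exists>a\<in>carrier R. a \<odot>\<^bsub>M\<^esub> x \<in> L - {\<zero>\<^bsub>M\<^esub>}" if x: "x \<in> carrier M - {\<zero>\<^bsub>M\<^esub>}" for x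
      proof -
        obtain a b where "a \<in> carrier R" "b \<in> carrier R" "a \<odot>\<^bsub>M\<^esub> x = b \<odot>\<^bsub>M\<^esub> y" "a \<odot>\<^bsub>M\<^esub> x \<noteq> \<zero>\<^bsub>M\<^esub>"
          using r x y submoduleD(1)[OF LD] by blast
        then show ?thesis
          using submoduleD(4)[OF LD, of b y] y by (metis Diff_iff singletonD)
      qed
      then show "essential_submodule R M L"
        using LD by (simp add: essential_submodule_iff)
    qed
  qed
  then show ?thesis
    using left_module_axioms by (simp add: uniform_module_def)
qed

lemma uniform_submodule_iff:
  assumes "submodule U R M"
  shows "uniform_module R (M\<lparr>carrier := U\<rparr>) \<longleftrightarrow> U \<noteq> {\<zero>\<^bsub>M\<^esub>} \<and>
    (\<forall>x\<in>U - {\<zero>\<^bsub>M\<^esub>}. \<forall>y\<in>U - {\<zero>\<^bsub>M\<^esub>}.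
      \<exists>a\<in>carrier R. \<exists>b\<in>carrier R. a \<odot>\<^bsub>M\<^esub> x = b \<odot>\<^bsub>M\<^esub> y \<and> a \<odot>\<^bsub>M\<^esub> x \<noteq> \<zero>\<^bsub>M\<^esub>)"
  using left_module.uniform_module_iff[OF left_module_submodule[OF assms]] by simp

end

subsection \<open>Homomorphisms and essential equivalence\<close>

text \<open>Shaped like \<open>left_module_iso\<close> without bijectivity, so that an isomorphism
  splits into a \<open>bij_betw\<close> fact and a homomorphism fact.\<close>

definition left_module_hom ::
    "('r, 'k) ring_scheme \<Rightarrow> ('r, 'a, 'm) module_scheme \<Rightarrow> ('r, 'b, 'n) module_scheme
      \<Rightarrow> ('a \<Rightarrow> 'b) set" where
  "left_module_hom R M M' =
    {f \<in> hom (add_monoid M) (add_monoid M').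
      \<forall>a\<in>carrier R. \<forall>x\<in>carrier M. f (a \<odot>\<^bsub>M\<^esub> x) = a \<odot>\<^bsub>M'\<^esub> f x}"

lemma left_module_homD:
  assumes "f \<in> left_module_hom R M M'"
  shows "x \<in> carrier M \<Longrightarrow> f x \<in> carrier M'"
    "\<lbrakk>x \<in> carrier M; y \<in> carrier M\<rbrakk> \<Longrightarrow> f (x \<oplus>\<^bsub>M\<^esub> y) = f x \<oplus>\<^bsub>M'\<^esub> f y"
    "\<lbrakk>a \<in> carrier R; x \<in> carrier M\<rbrakk> \<Longrightarrow> f (a \<odot>\<^bsub>M\<^esub> x) = a \<odot>\<^bsub>M'\<^esub> f x"
  using assms by (auto simp: left_module_hom_def hom_def)

lemma left_module_isoD:
  assumes "f \<in> left_module_iso R M M'"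
  shows "bij_betw f (carrier M) (carrier M')" "f \<in> left_module_hom R M M'"
  using assms by (auto simp: left_module_iso_def left_module_hom_def iso_def)

lemma left_module_isoI:
  assumes "bij_betw f (carrier M) (carrier M')" "f \<in> left_module_hom R M M'"
  shows "f \<in> left_module_iso R M M'"
  using assms by (auto simp: left_module_iso_def left_module_hom_def iso_def)

lemma left_module_iso_inv:
  assumes M: "left_module R M" and f: "f \<in> left_module_iso R M M'"
  shows "inv_into (carrier M) f \<in> left_module_iso R M' M"
proof (rule left_module_isoI)
  interpret left_module R M by fact
  note b = left_module_isoD(1)[OF f] and fD = left_module_homD[OF left_module_isoD(2)[OF f]]
  let ?g = "inv_into (carrier M) f"
  show "bij_betw ?g (carrier M') (carrier M)"
    using b by (rule bij_betw_inv_into)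
  have gf: "?g (f x) = x" if "x \<in> carrier M" for x
    using that b by (simp add: bij_betw_inv_into_left)
  have im: "\<exists>x\<in>carrier M. y = f x" if "y \<in> carrier M'" for y
    using that b by (auto simp: bij_betw_def)
  show "?g \<in> left_module_hom R M' M"
    unfolding left_module_hom_def hom_def
    by (auto dest!: im simp: gf simp flip: fD(2,3))
qed

lemma left_module_iso_trans:
  assumes "f \<in> left_module_iso R M M'" "g \<in> left_module_iso R M' M''"
  shows "g \<circ> f \<in> left_module_iso R M M''"
proof (rule left_module_isoI)
  note f = left_module_isoD[OF assms(1)] and g = left_module_isoD[OF assms(2)]
  show "bij_betw (g \<circ> f) (carrier M) (carrier M'')"
    using f(1) g(1) by (rule bij_betw_trans)
  show "g \<circ> f \<in> left_module_hom R M M''"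
    using left_module_homD[OF f(2)] left_module_homD[OF g(2)]
    by (auto simp: left_module_hom_def hom_def)
qed

lemma left_module_iso_restrict:
  assumes f: "f \<in> left_module_iso R (M\<lparr>carrier := L\<rparr>) (M'\<lparr>carrier := L'\<rparr>)" and "K \<subseteq> L"
  shows "f \<in> left_module_iso R (M\<lparr>carrier := K\<rparr>) (M'\<lparr>carrier := f ` K\<rparr>)"
proof (rule left_module_isoI)
  show "bij_betw f (carrier (M\<lparr>carrier := K\<rparr>)) (carrier (M'\<lparr>carrier := f ` K\<rparr>))"
    using left_module_isoD(1)[OF f] \<open>K \<subseteq> L\<close> by (auto simp: bij_betw_def inj_on_subset)
  show "f \<in> left_module_hom R (M\<lparr>carrier := K\<rparr>) (M'\<lparr>carrier := f ` K\<rparr>)"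
    using left_module_homD[OF left_module_isoD(2)[OF f]] subsetD[OF \<open>K \<subseteq> L\<close>]
    by (auto simp: left_module_hom_def hom_def)
qed

lemma hom_zero:
  assumes "left_module R M" "left_module R M'" "f \<in> left_module_hom R M M'"
  shows "f \<zero>\<^bsub>M\<^esub> = \<zero>\<^bsub>M'\<^esub>"
proof -
  interpret M: left_module R M by fact
  interpret M': left_module R M' by fact
  have "f (\<zero>\<^bsub>R\<^esub> \<odot>\<^bsub>M\<^esub> \<zero>\<^bsub>M\<^esub>) = \<zero>\<^bsub>R\<^esub> \<odot>\<^bsub>M'\<^esub> f \<zero>\<^bsub>M\<^esub>"
    by (intro left_module_homD(3)[OF assms(3)]) auto
  then show ?thesis
    using left_module_homD(1)[OF assms(3), of "\<zero>\<^bsub>M\<^esub>"] by simp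
qed

lemma hom_minus:
  assumes "left_module R M" "left_module R M'" "f \<in> left_module_hom R M M'" "x \<in> carrier M"
  shows "f (\<ominus>\<^bsub>M\<^esub> x) = \<ominus>\<^bsub>M'\<^esub> f x"
proof -
  interpret M: left_module R M by fact
  interpret M': left_module R M' by fact
  show ?thesis
    using left_module_homD[OF assms(3)] assms(4)
    by (simp flip: M.smult_minus_one M'.smult_minus_one)
qed

lemma hom_image_submodule:
  assumes "left_module R M" "left_module R M'" and f: "f \<in> left_module_hom R M M'"
    and K: "submodule K R M"
  shows "submodule (f ` K) R M'"
proof -
  interpret M: left_module R M by fact
  interpret M': left_module R M' by fact
  note fD = left_module_homD[OF f] and KD = M.submoduleD[OF K]
  show ?thesis
  proof (rule M'.submoduleI)
    show "f ` K \<subseteq> carrier M'"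
      using fD KD by auto
    show "\<zero>\<^bsub>M'\<^esub> \<in> f ` K"
      using hom_zero[OF assms(1-3)] KD(2) by (metis imageI)
  next
    fix x y assume "x \<in> f ` K" "y \<in> f ` K"
    then obtain u v where "u \<in> K" "v \<in> K" "x = f u" "y = f v" by blast
    then show "x \<oplus>\<^bsub>M'\<^esub> y \<in> f ` K"
      using fD(2)[of u v] KD by (metis imageI)
  next
    fix a x assume a: "a \<in> carrier R" and "x \<in> f ` K"
    then obtain u where "u \<in> K" "x = f u" by blast
    then show "a \<odot>\<^bsub>M'\<^esub> x \<in> f ` K"
      using fD(3)[OF a, of u] KD(1)[of u] KD(4)[OF a, of u] by (metis imageI)
  qed
qed

lemma hom_vimage_submodule:
  assumes "left_module R M" "left_module R M'" and f: "f \<in> left_module_hom R M M'"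
    and K: "submodule K R M'"
  shows "submodule {x \<in> carrier M. f x \<in> K} R M"
proof -
  interpret M: left_module R M by fact
  interpret M': left_module R M' by fact
  show ?thesis
    by (rule M.submoduleI)
      (use left_module_homD[OF f] M'.submoduleD[OF K] hom_zero[OF assms(1-3)] in auto)
qed

section \<open>Essential equivalence is symmetric and transitive\<close>

lemma essentially_equivalent_sym:
  assumes "left_module R M" "essentially_equivalent R M M'"
  shows "essentially_equivalent R M' M"
proof -
  interpret M: left_module R M by fact
  from assms(2) obtain L L' f where *: "essential_submodule R M L" "essential_submodule R M' L'"
    "f \<in> left_module_iso R (M\<lparr>carrier := L\<rparr>) (M'\<lparr>carrier := L'\<rparr>)"
    unfolding essentially_equivalent_def by blast
  then show ?thesis
    unfolding essentially_equivalent_def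
    using left_module_iso_inv[OF M.left_module_submodule *(3)]
    by (metis empty_iff essential_submodule_def)
qed

text \<open>
  The isomorphisms \<open>f: L\<^sub>1 \<cong> L\<^sub>2\<close> and \<open>g: K\<^sub>2 \<cong> K\<^sub>3\<close> compose on the preimage of \<open>L\<^sub>2 \<inter> K\<^sub>2\<close>.
\<close>

lemma essentially_equivalent_trans:
  assumes M1: "left_module R M1" and M2: "left_module R M2" and M3: "left_module R M3"
    and "essentially_equivalent R M1 M2" "essentially_equivalent R M2 M3"
  shows "essentially_equivalent R M1 M3"
proof -
  interpret M1: left_module R M1 by fact
  interpret M2: left_module R M2 by fact
  interpret M3: left_module R M3 by fact
  from assms(4) obtain L1 L2 f where L: "essential_submodule R M1 L1" "essential_submodule R M2 L2"
    and f: "f \<in> left_module_iso R (M1\<lparr>carrier := L1\<rparr>) (M2\<lparr>carrier := L2\<rparr>)"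
    unfolding essentially_equivalent_def by blast
  from assms(5) obtain K2 K3 g where K: "essential_submodule R M2 K2" "essential_submodule R M3 K3"
    and g: "g \<in> left_module_iso R (M2\<lparr>carrier := K2\<rparr>) (M3\<lparr>carrier := K3\<rparr>)"
    unfolding essentially_equivalent_def by blast
  note LE = L[unfolded M1.essential_submodule_iff M2.essential_submodule_iff]
    and KE = K[unfolded M2.essential_submodule_iff M3.essential_submodule_iff]
  have L1: "submodule L1 R M1" and L2: "submodule L2 R M2"
    and K2: "submodule K2 R M2" and K3: "submodule K3 R M3"
    using LE KE by auto
  note lL1 = M1.left_module_submodule[OF L1] and lL2 = M2.left_module_submodule[OF L2]
    and lK2 = M2.left_module_submodule[OF K2] and lK3 = M3.left_module_submodule[OF K3]
  let ?H = "{x \<in> L1. f x \<in> L2 \<inter> K2}"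
  have fbij: "bij_betw f L1 L2" and gbij: "bij_betw g K2 K3"
    using left_module_isoD(1)[OF f] left_module_isoD(1)[OF g] by auto
  note fD = left_module_homD[OF left_module_isoD(2)[OF f], simplified]
    and gD = left_module_homD[OF left_module_isoD(2)[OF g], simplified]
  have fz: "f \<zero>\<^bsub>M1\<^esub> = \<zero>\<^bsub>M2\<^esub>" and gz: "g \<zero>\<^bsub>M2\<^esub> = \<zero>\<^bsub>M3\<^esub>"
    using hom_zero[OF lL1 lL2 left_module_isoD(2)[OF f]] hom_zero[OF lK2 lK3 left_module_isoD(2)[OF g]]
    by auto
  have "submodule (L2 \<inter> K2) R (M2\<lparr>carrier := L2\<rparr>)"
    using M2.submodule_Int[OF L2 K2] M2.submodule_submodule_iff[OF L2] by simp
  from hom_vimage_submodule[OF lL1 lL2 left_module_isoD(2)[OF f] this]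
  have H: "submodule ?H R M1"
    using M1.submodule_submodule_iff[OF L1] by simp
  have fz_iff: "f x = \<zero>\<^bsub>M2\<^esub> \<longleftrightarrow> x = \<zero>\<^bsub>M1\<^esub>" if "x \<in> L1" for x
    using that fz M1.submoduleD(2)[OF L1] fbij by (metis bij_betw_def inj_on_eq_iff)
  have gz_iff: "g x = \<zero>\<^bsub>M3\<^esub> \<longleftrightarrow> x = \<zero>\<^bsub>M2\<^esub>" if "x \<in> K2" for x
    using that gz M2.submoduleD(2)[OF K2] gbij by (metis bij_betw_def inj_on_eq_iff)
  have fH: "f ` ?H = L2 \<inter> K2"
    using fbij by (auto simp: bij_betw_def)
  \<comment> \<open>Two multiplications are combined: the first takes x into \<open>L1\<close>, the
    second takes the image of the result under \<open>f\<close> into \<open>K2\<close>. Injectivity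
    of \<open>f\<close> on \<open>L1\<close> keeps the intermediate image nonzero.\<close>
  have eH: "essential_submodule R M1 ?H"
    unfolding M1.essential_submodule_iff
  proof (intro conjI H ballI)
    fix x assume x: "x \<in> carrier M1 - {\<zero>\<^bsub>M1\<^esub>}"
    then obtain a where a: "a \<in> carrier R" "a \<odot>\<^bsub>M1\<^esub> x \<in> L1 - {\<zero>\<^bsub>M1\<^esub>}"
      using LE by blast
    then have "f (a \<odot>\<^bsub>M1\<^esub> x) \<in> carrier M2 - {\<zero>\<^bsub>M2\<^esub>}"
      using fz_iff fD(1) M2.submoduleD(1)[OF L2] by auto
    then obtain b where b: "b \<in> carrier R" "b \<odot>\<^bsub>M2\<^esub> f (a \<odot>\<^bsub>M1\<^esub> x) \<in> K2 - {\<zero>\<^bsub>M2\<^esub>}"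
      using KE by blast
    then have c: "f (b \<odot>\<^bsub>M1\<^esub> (a \<odot>\<^bsub>M1\<^esub> x)) \<in> K2 - {\<zero>\<^bsub>M2\<^esub>}" "b \<odot>\<^bsub>M1\<^esub> (a \<odot>\<^bsub>M1\<^esub> x) \<in> L1"
      using a fD(3) M1.submoduleD(4)[OF L1] by auto
    then have "b \<odot>\<^bsub>M1\<^esub> (a \<odot>\<^bsub>M1\<^esub> x) \<in> ?H - {\<zero>\<^bsub>M1\<^esub>}"
      using fz fD(1) by auto
    then show "\<exists>a\<in>carrier R. a \<odot>\<^bsub>M1\<^esub> x \<in> ?H - {\<zero>\<^bsub>M1\<^esub>}"
      using a b x M1.smult_assoc1[of b a x] by (metis DiffD1 M1.R.m_closed)
  qed
  let ?G = "g ` (L2 \<inter> K2)"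
  have G: "submodule ?G R M3"
    using hom_image_submodule[OF lK2 lK3 left_module_isoD(2)[OF g], of "L2 \<inter> K2"]
      M2.submodule_Int[OF L2 K2] M2.submodule_submodule_iff[OF K2] M3.submodule_submodule_iff[OF K3]
    by simp
  \<comment> \<open>Here z is first multiplied into \<open>K3\<close> and pulled back along
    \<open>g\<close> to y in \<open>K2\<close>; then y is multiplied into \<open>L2\<close>, and
    injectivity of \<open>g\<close> keeps the image nonzero.\<close>
  have eG: "essential_submodule R M3 ?G"
    unfolding M3.essential_submodule_iff
  proof (intro conjI G ballI)
    fix z assume z: "z \<in> carrier M3 - {\<zero>\<^bsub>M3\<^esub>}"
    then obtain a where a: "a \<in> carrier R" "a \<odot>\<^bsub>M3\<^esub> z \<in> K3 - {\<zero>\<^bsub>M3\<^esub>}"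
      using KE by blast
    then obtain y where y: "y \<in> K2" "a \<odot>\<^bsub>M3\<^esub> z = g y"
      using gbij by (auto simp: bij_betw_def)
    then have "y \<in> carrier M2 - {\<zero>\<^bsub>M2\<^esub>}"
      using a gz M2.submoduleD(1)[OF K2] by auto
    then obtain b where b: "b \<in> carrier R" "b \<odot>\<^bsub>M2\<^esub> y \<in> L2 - {\<zero>\<^bsub>M2\<^esub>}"
      using LE by blast
    then have c: "b \<odot>\<^bsub>M2\<^esub> y \<in> L2 \<inter> K2" "b \<odot>\<^bsub>M2\<^esub> y \<noteq> \<zero>\<^bsub>M2\<^esub>"
      using y M2.submoduleD(4)[OF K2] by auto
    then have "g (b \<odot>\<^bsub>M2\<^esub> y) \<in> ?G - {\<zero>\<^bsub>M3\<^esub>}"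
      using gz_iff by auto
    moreover have "g (b \<odot>\<^bsub>M2\<^esub> y) = (b \<otimes>\<^bsub>R\<^esub> a) \<odot>\<^bsub>M3\<^esub> z"
      using gD(3)[OF b(1) y(1)] y(2) a b z by (simp add: M3.smult_assoc1)
    ultimately show "\<exists>a\<in>carrier R. a \<odot>\<^bsub>M3\<^esub> z \<in> ?G - {\<zero>\<^bsub>M3\<^esub>}"
      using a b by (metis M1.R.m_closed)
  qed
  have "f \<in> left_module_iso R (M1\<lparr>carrier := ?H\<rparr>) (M2\<lparr>carrier := L2 \<inter> K2\<rparr>)"
    using left_module_iso_restrict[OF f, of ?H] by (simp only: fH) auto
  moreover have "g \<in> left_module_iso R (M2\<lparr>carrier := L2 \<inter> K2\<rparr>) (M3\<lparr>carrier := ?G\<rparr>)"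
    using left_module_iso_restrict[OF g, of "L2 \<inter> K2"] by simp
  ultimately have "g \<circ> f \<in> left_module_iso R (M1\<lparr>carrier := ?H\<rparr>) (M3\<lparr>carrier := ?G\<rparr>)"
    by (rule left_module_iso_trans)
  then show ?thesis
    unfolding essentially_equivalent_def using eH eG by blast
qed

lemma essential_class_eqI:
  assumes "left_module R M" "left_module R M'" "essentially_equivalent R M M'"
  shows "essential_class R M = essential_class R M'"
  unfolding essential_class_def
  using assms essentially_equivalent_sym essentially_equivalent_trans by blast

subsection \<open>Direct sequences and uniform submodules\<close>

text \<open>If f x = f y, then x - y lies in K and is mapped to zero. Only the kernel inside K
  matters, as the canonical maps used later are injective merely on a submodule.\<close>

lemma hom_inj_on:
  assumes "left_module R M" "left_module R M'" and f: "f \<in> left_module_hom R M M'"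
    and K: "submodule K R M" and ker: "\<And>x. \<lbrakk>x \<in> K; f x = \<zero>\<^bsub>M'\<^esub>\<rbrakk> \<Longrightarrow> x = \<zero>\<^bsub>M\<^esub>"
  shows "inj_on f K"
proof (rule inj_onI)
  interpret M: left_module R M by fact
  interpret M': left_module R M' by fact
  note KD = M.submoduleD[OF K]
  fix x y assume xy: "x \<in> K" "y \<in> K" "f x = f y"
  then have "f (x \<oplus>\<^bsub>M\<^esub> \<ominus>\<^bsub>M\<^esub> y) = \<zero>\<^bsub>M'\<^esub>"
    using KD left_module_homD[OF f] hom_minus[OF assms(1-3)] by (simp add: M'.r_neg)
  then have "x \<oplus>\<^bsub>M\<^esub> \<ominus>\<^bsub>M\<^esub> y = \<zero>\<^bsub>M\<^esub>"
    by (intro ker KD(3,5) xy)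
  then show "x = y"
    using KD(1) xy M.minus_equality[of x "\<ominus>\<^bsub>M\<^esub> y"] by simp
qed

context left_module
begin

lemma essential_submodule_carrier: "essential_submodule R M (carrier M)"
  unfolding essential_submodule_iff
  using submodule_carrier by (metis DiffD1 R.one_closed smult_one)

text \<open>In a vanishing sum let m be the least index. All later terms lie in \<open>K m\<close>,
  because \<open>U (Suc i) \<subseteq> K i \<subseteq> K m\<close> for i at least m. Hence the m-th
  term lies in \<open>U m \<inter> K m\<close> and is zero, and the shorter sum is treated by
  induction.\<close>

lemma sequence_independent:
  assumes U: "\<And>n. submodule (U n) R M" and K: "\<And>n. submodule (K n) R M"
    and UK: "\<And>n. U (Suc n) \<subseteq> K n" and dec: "\<And>n. K (Suc n) \<subseteq> K n"
    and disj: "\<And>n. U n \<inter> K n = {\<zero>\<^bsub>M\<^esub>}"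
    and "finite J" "\<And>j. j \<in> J \<Longrightarrow> y j \<in> U j" "(\<Oplus>\<^bsub>M\<^esub>j\<in>J. y j) = \<zero>\<^bsub>M\<^esub>"
  shows "\<forall>j\<in>J. y j = \<zero>\<^bsub>M\<^esub>"
  using assms(6-8)
proof (induction J rule: finite_linorder_min_induct)
  case empty
  then show ?case by simp
next
  case (insert m J)
  have anti: "K n \<subseteq> K m" if "m \<le> n" for m n
    using lift_Suc_antimono_le[of K, OF dec that] .
  \<comment> \<open>The index j is written as a successor because the inclusion into the sequence K
    is indexed with a shift by one.\<close>
  have yK: "y j \<in> K m" if "j \<in> J" for j
  proof -
    have "m < j"
      using insert.hyps(2) that by blast
    then obtain k where "j = Suc (m + k)"
      by (blast dest: less_imp_Suc_add)
    then obtain i where "j = Suc i" "m \<le> i"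
      by simp
    then show ?thesis
      using UK[of i] anti[of m i] insert.prems(1)[of j] that by auto
  qed
  have car: "y \<in> J \<rightarrow> carrier M" "y m \<in> carrier M"
    using insert.prems(1) submoduleD(1)[OF U] by auto
  have "(\<Oplus>\<^bsub>M\<^esub>j\<in>F. y j) \<in> K m" if "finite F" "F \<subseteq> J" for F
    using that
  proof (induction F)
    case empty
    then show ?case using submoduleD(2)[OF K] by simp
  next
    case (insert x F)
    then have "y \<in> F \<rightarrow> carrier M" "y x \<in> carrier M"
      using car by auto
    with insert show ?case
      using yK submoduleD(3)[OF K] by auto
  qed
  then have s: "(\<Oplus>\<^bsub>M\<^esub>j\<in>J. y j) \<in> K m"
    using insert.hyps(1) by blast
  have "m \<notin> J"
    using insert.hyps(2) by blast
  then have sum: "y m \<oplus>\<^bsub>M\<^esub> (\<Oplus>\<^bsub>M\<^esub>j\<in>J. y j) = \<zero>\<^bsub>M\<^esub>"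
    using insert.prems(2) insert.hyps(1) car by simp
  then have "y m = \<ominus>\<^bsub>M\<^esub> (\<Oplus>\<^bsub>M\<^esub>j\<in>J. y j)"
    using car by (metis M.finsum_closed M.minus_equality)
  then have "y m \<in> U m \<inter> K m"
    using submoduleD(5)[OF K s] insert.prems(1)[of m] by simp
  then have ym: "y m = \<zero>\<^bsub>M\<^esub>"
    using disj by blast
  then have "(\<Oplus>\<^bsub>M\<^esub>j\<in>J. y j) = \<zero>\<^bsub>M\<^esub>"
    using sum car by simp
  then show ?case
    using insert.IH insert.prems(1) ym by blast
qed

text \<open>The common obstruction behind both termination arguments: splitting off uniform
  submodules, and building a decomposition. Each \<open>U n\<close> is set aside while everything
  chosen later stays inside \<open>K n\<close>.\<close>

lemma not_finite_uniform_dimI: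
  assumes U: "\<And>n. nonzero_submodule R M (U n)" and K: "\<And>n. submodule (K n) R M"
    and UK: "\<And>n. U (Suc n) \<subseteq> K n" and dec: "\<And>n. K (Suc n) \<subseteq> K n"
    and disj: "\<And>n. U n \<inter> K n = {\<zero>\<^bsub>M\<^esub>}"
  shows "\<not> finite_uniform_dim R M"
proof -
  have Us: "submodule (U n) R M" and Un: "U n \<noteq> {\<zero>\<^bsub>M\<^esub>}" for n
    using U by (auto simp: nonzero_submodule_def)
  \<comment> \<open>Since \<open>U n\<close> lies in \<open>K m\<close> and \<open>U m\<close> meets
    \<open>K m\<close> trivially, equality would make \<open>U n\<close> zero. Distinctness makes
    the set of members infinite.\<close>
  have "U m \<noteq> U n" if mn: "m < n" for m n
  proof -
    obtain k where "n = Suc (m + k)"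
      using less_imp_Suc_add[OF mn] by blast
    then obtain i where "n = Suc i" "m \<le> i"
      by simp
    then have "U n \<subseteq> K m"
      using UK[of i] lift_Suc_antimono_le[of K, OF dec, of m i] by auto
    then show ?thesis
      using disj[of m] Un[of n] by blast
  qed
  then have inj: "inj U"
    by (metis injI linorder_neqE_nat)
  \<comment> \<open>The family is indexed by its own members; injectivity of \<open>U\<close> turns
    a sum over members into a sum over natural numbers.\<close>
  have "direct_sum_family M (range U) (\<lambda>L. L)"
    unfolding direct_sum_family_def
  proof (intro allI impI, elim conjE)
    fix F :: "'a set set" and x
    assume F: "finite F" "F \<subseteq> range U" "\<forall>L\<in>F. x L \<in> L" "(\<Oplus>\<^bsub>M\<^esub>L\<in>F. x L) = \<zero>\<^bsub>M\<^esub>"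
    define J where "J = U -` F"
    have J: "finite J" "F = U ` J"
      using F inj by (auto simp: J_def finite_vimageI)
    have xJ: "x (U j) \<in> U j" if "j \<in> J" for j
      using F(3) that J by auto
    then have "x \<in> U ` J \<rightarrow> carrier M"
      using submoduleD(1)[OF Us] by blast
    then have "(\<Oplus>\<^bsub>M\<^esub>j\<in>J. x (U j)) = \<zero>\<^bsub>M\<^esub>"
      using F(4) J inj M.finsum_reindex[of x U J] by (simp add: inj_on_subset)
    then have "\<forall>j\<in>J. x (U j) = \<zero>\<^bsub>M\<^esub>"
      using sequence_independent[of U K J "\<lambda>j. x (U j)", OF Us K UK dec disj J(1) xJ] by blast
    then show "\<forall>L\<in>F. x L = \<zero>\<^bsub>M\<^esub>"
      using J by auto
  qed
  moreover have "infinite (range U)"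
    using inj by (simp add: finite_image_iff)
  ultimately show ?thesis
    unfolding finite_uniform_dim_def using U by blast
qed

text \<open>Failure of the common multiple criterion supplies nonzero x and y in B with Rx and Ry
  meeting only in zero; these are the two pieces.\<close>

lemma nonzero_submodule_not_uniform_split:
  assumes B: "nonzero_submodule R M B" and "\<not> uniform_module R (M\<lparr>carrier := B\<rparr>)"
  shows "\<exists>U K. nonzero_submodule R M U \<and> nonzero_submodule R M K \<and> U \<subseteq> B \<and> K \<subseteq> B \<and>
    U \<inter> K = {\<zero>\<^bsub>M\<^esub>}"
proof -
  have Bs: "submodule B R M"
    using B by (simp add: nonzero_submodule_def)
  obtain x y where xy: "x \<in> B" "x \<noteq> \<zero>\<^bsub>M\<^esub>" "y \<in> B" "y \<noteq> \<zero>\<^bsub>M\<^esub>"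
    and no: "\<And>a b. \<lbrakk>a \<in> carrier R; b \<in> carrier R; a \<odot>\<^bsub>M\<^esub> x = b \<odot>\<^bsub>M\<^esub> y\<rbrakk> \<Longrightarrow> a \<odot>\<^bsub>M\<^esub> x = \<zero>\<^bsub>M\<^esub>"
    using assms uniform_submodule_iff[OF Bs] unfolding nonzero_submodule_def by blast
  have car: "x \<in> carrier M" "y \<in> carrier M"
    using xy submoduleD(1)[OF Bs] by auto
  let ?U = "{a \<odot>\<^bsub>M\<^esub> x | a. a \<in> carrier R}" and ?K = "{a \<odot>\<^bsub>M\<^esub> y | a. a \<in> carrier R}"
  have "?U \<subseteq> B" "?K \<subseteq> B"
    using xy submoduleD(4)[OF Bs] by auto
  moreover have "nonzero_submodule R M ?U" "nonzero_submodule R M ?K"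
    unfolding nonzero_submodule_def
    using xy car submodule_cyclic cyclic_self by blast+
  moreover have "?U \<inter> ?K = {\<zero>\<^bsub>M\<^esub>}"
  proof (intro equalityI subsetI)
    show "z \<in> {\<zero>\<^bsub>M\<^esub>}" if "z \<in> ?U \<inter> ?K" for z
      using that no by blast
    show "z \<in> ?U \<inter> ?K" if "z \<in> {\<zero>\<^bsub>M\<^esub>}" for z
      using that submoduleD(2)[OF submodule_cyclic] car by blast
  qed
  ultimately show ?thesis
    by blast
qed

text \<open>Otherwise B and all its nonzero submodules split. Keeping one piece and splitting the
  other again, by dependent choice, yields an infinite direct sum.\<close>

lemma contains_uniform_submodule:
  assumes fin: "finite_uniform_dim R M" and B: "nonzero_submodule R M B"
  shows "\<exists>U. submodule U R M \<and> U \<subseteq> B \<and> uniform_module R (M\<lparr>carrier := U\<rparr>)"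
proof (rule ccontr)
  assume none: "\<not> ?thesis"
  have split: "\<exists>U K. nonzero_submodule R M U \<and> nonzero_submodule R M K \<and> U \<subseteq> C \<and> K \<subseteq> C \<and>
    U \<inter> K = {\<zero>\<^bsub>M\<^esub>}" if "nonzero_submodule R M C" "C \<subseteq> B" for C
    using nonzero_submodule_not_uniform_split[OF that(1)] none that
    unfolding nonzero_submodule_def by blast
  \<comment> \<open>In a pair, the first component is the piece set aside and the second is the
    piece to be split next.\<close>
  define P where "P p \<longleftrightarrow> nonzero_submodule R M (fst p) \<and> nonzero_submodule R M (snd p) \<and>
    snd p \<subseteq> B \<and> fst p \<inter> snd p = {\<zero>\<^bsub>M\<^esub>}" for p :: "'a set \<times> 'a set"
  have ex: "\<exists>p. P p"
    using split[OF B] unfolding P_def by auto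
  have step: "\<exists>q. P q \<and> fst q \<subseteq> snd p \<and> snd q \<subseteq> snd p" if p: "P p" for p
  proof -
    have sp: "nonzero_submodule R M (snd p)" "snd p \<subseteq> B"
      using p by (auto simp: P_def)
    from split[OF sp] obtain U K where "nonzero_submodule R M U" "nonzero_submodule R M K"
      "U \<subseteq> snd p" "K \<subseteq> snd p" "U \<inter> K = {\<zero>\<^bsub>M\<^esub>}"
      by blast
    then show ?thesis
      using p unfolding P_def by (intro exI[of _ "(U, K)"]) auto
  qed
  have "\<exists>s. \<forall>n. P (s n) \<and> fst (s (Suc n)) \<subseteq> snd (s n) \<and> snd (s (Suc n)) \<subseteq> snd (s n)"
    by (rule dependent_nat_choice) (use ex step in blast)+
  then obtain s where s: "\<And>n. P (s n)"
    "\<And>n. fst (s (Suc n)) \<subseteq> snd (s n) \<and> snd (s (Suc n)) \<subseteq> snd (s n)"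
    by blast
  have "\<not> finite_uniform_dim R M"
    by (rule not_finite_uniform_dimI[of "\<lambda>n. fst (s n)" "\<lambda>n. snd (s n)"])
      (use s in \<open>auto simp: P_def nonzero_submodule_def\<close>)
  then show False
    using fin by blast
qed

end

section \<open>Transport of uniform submodules and their classes\<close>

text \<open>A common nonzero multiple of x and y in U is sent by f to one of f x and f y, and
  injectivity on U keeps it nonzero.\<close>

lemma uniform_hom_image:
  assumes M: "left_module R M" and M': "left_module R M'" and f: "f \<in> left_module_hom R M M'"
    and U: "submodule U R M" "uniform_module R (M\<lparr>carrier := U\<rparr>)" and inj: "inj_on f U"
  shows "uniform_module R (M'\<lparr>carrier := f ` U\<rparr>)"
proof -
  interpret M: left_module R M by fact
  interpret M': left_module R M' by fact
  note fD = left_module_homD[OF f] and UD = M.submoduleD[OF U(1)]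
  have fz: "f x = \<zero>\<^bsub>M'\<^esub> \<longleftrightarrow> x = \<zero>\<^bsub>M\<^esub>" if "x \<in> U" for x
    using that inj UD(2) hom_zero[OF M M' f] by (metis inj_on_eq_iff)
  have u: "U \<noteq> {\<zero>\<^bsub>M\<^esub>}" "\<And>x y. \<lbrakk>x \<in> U - {\<zero>\<^bsub>M\<^esub>}; y \<in> U - {\<zero>\<^bsub>M\<^esub>}\<rbrakk> \<Longrightarrow>
      \<exists>a\<in>carrier R. \<exists>b\<in>carrier R. a \<odot>\<^bsub>M\<^esub> x = b \<odot>\<^bsub>M\<^esub> y \<and> a \<odot>\<^bsub>M\<^esub> x \<noteq> \<zero>\<^bsub>M\<^esub>"
    using U M.uniform_submodule_iff[OF U(1)] by auto
  show ?thesis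
    unfolding M'.uniform_submodule_iff[OF hom_image_submodule[OF M M' f U(1)]]
  proof (intro conjI ballI)
    show "f ` U \<noteq> {\<zero>\<^bsub>M'\<^esub>}"
      using u(1) fz UD(2) by blast
    fix x' y' assume "x' \<in> f ` U - {\<zero>\<^bsub>M'\<^esub>}" "y' \<in> f ` U - {\<zero>\<^bsub>M'\<^esub>}"
    then obtain x y where xy: "x \<in> U - {\<zero>\<^bsub>M\<^esub>}" "y \<in> U - {\<zero>\<^bsub>M\<^esub>}" "x' = f x" "y' = f y"
      using fz by auto
    then obtain a b where ab: "a \<in> carrier R" "b \<in> carrier R" "a \<odot>\<^bsub>M\<^esub> x = b \<odot>\<^bsub>M\<^esub> y"
      "a \<odot>\<^bsub>M\<^esub> x \<noteq> \<zero>\<^bsub>M\<^esub>"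
      using u(2) by blast
    then have "f (a \<odot>\<^bsub>M\<^esub> x) = f (b \<odot>\<^bsub>M\<^esub> y)" "f (a \<odot>\<^bsub>M\<^esub> x) \<noteq> \<zero>\<^bsub>M'\<^esub>"
      using fz UD(4) xy by auto
    moreover have "f (a \<odot>\<^bsub>M\<^esub> x) = a \<odot>\<^bsub>M'\<^esub> x'" "f (b \<odot>\<^bsub>M\<^esub> y) = b \<odot>\<^bsub>M'\<^esub> y'"
      using fD(3)[OF ab(1), of x] fD(3)[OF ab(2), of y] xy UD(1) by auto
    ultimately show "\<exists>a\<in>carrier R. \<exists>b\<in>carrier R. a \<odot>\<^bsub>M'\<^esub> x' = b \<odot>\<^bsub>M'\<^esub> y' \<and> a \<odot>\<^bsub>M'\<^esub> x' \<noteq> \<zero>\<^bsub>M'\<^esub>"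
      using ab by metis
  qed
qed

text \<open>The restriction of f is an isomorphism of U onto its image, so the two whole modules
  serve as the essential submodules.\<close>

lemma essential_class_hom_image:
  assumes M: "left_module R M" and M': "left_module R M'" and f: "f \<in> left_module_hom R M M'"
    and U: "submodule U R M" and inj: "inj_on f U"
  shows "essential_class R (M\<lparr>carrier := U\<rparr>) = essential_class R (M'\<lparr>carrier := f ` U\<rparr>)"
proof (rule essential_class_eqI)
  let ?A = "M\<lparr>carrier := U\<rparr>" and ?B = "M'\<lparr>carrier := f ` U\<rparr>"
  show A: "left_module R ?A"
    using M U by (rule left_module.left_module_submodule)
  show B: "left_module R ?B"
    using M' hom_image_submodule[OF M M' f U] by (rule left_module.left_module_submodule)
  have "f \<in> left_module_iso R ?A ?B"
    by (rule left_module_isoI)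
      (use inj left_module_homD[OF f] left_module.submoduleD[OF M U] in
        \<open>auto simp: bij_betw_def left_module_hom_def hom_def\<close>)
  then show "essentially_equivalent R ?A ?B"
    unfolding essentially_equivalent_def
    using left_module.essential_submodule_carrier[OF A] left_module.essential_submodule_carrier[OF B]
    by (intro exI[of _ U] exI[of _ "f ` U"]) auto
qed

text \<open>The way in which associated left primes pass from one module to another: an embedded
  uniform submodule takes its class along.\<close>

lemma associated_left_prime_hom_image:
  assumes M: "left_module R M" and M': "left_module R M'" and f: "f \<in> left_module_hom R M M'"
    and U: "submodule U R M" "uniform_module R (M\<lparr>carrier := U\<rparr>)" and inj: "inj_on f U"
  shows "essential_class R (M\<lparr>carrier := U\<rparr>) \<in> associated_left_primes R M'"
  unfolding associated_left_primes_def
  using hom_image_submodule[OF M M' f U(1)] uniform_hom_image[OF assms]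
    essential_class_hom_image[OF M M' f U(1) inj] by blast

text \<open>Each nonzero submodule U of a uniform module is essential both in itself and in the
  module, so the identity on U shows that both have the same class. The class of the whole module
  occurs with U the full carrier.\<close>

lemma associated_left_primes_uniform:
  assumes "uniform_module R M"
  shows "associated_left_primes R M = {essential_class R M}"
proof -
  interpret left_module R M
    using assms by (simp add: uniform_module_def)
  have "essential_class R (M\<lparr>carrier := U\<rparr>) = essential_class R M"
    if U: "submodule U R M" "uniform_module R (M\<lparr>carrier := U\<rparr>)" for U
  proof (rule essential_class_eqI)
    show l: "left_module R (M\<lparr>carrier := U\<rparr>)" "left_module R M"
      using left_module_submodule[OF U(1)] left_module_axioms by auto
    have "nonzero_submodule R M U"
      using U by (simp add: nonzero_submodule_def uniform_module_def)
    then have "essential_submodule R M U"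
      using assms by (simp add: uniform_module_def)
    moreover have "essential_submodule R (M\<lparr>carrier := U\<rparr>) U"
      using left_module.essential_submodule_carrier[OF l(1)] by simp
    moreover have "id \<in> left_module_iso R (M\<lparr>carrier := U\<rparr>) (M\<lparr>carrier := U\<rparr>)"
      by (auto simp: left_module_iso_def iso_def hom_def)
    ultimately show "essentially_equivalent R (M\<lparr>carrier := U\<rparr>) M"
      unfolding essentially_equivalent_def by (intro exI[of _ U]) auto
  qed
  moreover have "uniform_module R (M\<lparr>carrier := carrier M\<rparr>)"
    using assms by simp
  ultimately show ?thesis
    unfolding associated_left_primes_def using submodule_carrier by blast
qed

subsection \<open>Factor modules\<close>

lemma factor_module_simps [simp]:
  "zero (factor_module M N) = N"
  "add (factor_module M N) = set_add M"
  "carrier (factor_module M N) = a_rcosets\<^bsub>M\<^esub> N"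
  by (simp_all add: factor_module_def)

lemma carrier_factor_module: "a_rcosets\<^bsub>M\<^esub> N = (\<lambda>x. N +>\<^bsub>M\<^esub> x) ` carrier M"
  by (auto simp: A_RCOSETS_def')

context left_module
begin

lemma abelian_subgroup_submodule:
  assumes "submodule N R M"
  shows "abelian_subgroup N M"
  using submodule.axioms(1)[OF assms] M.abelian_group_axioms
  by (intro abelian_subgroupI3 additive_subgroup.intro)

lemma coset_add:
  assumes "submodule N R M" "x \<in> carrier M" "y \<in> carrier M"
  shows "(N +>\<^bsub>M\<^esub> x) <+>\<^bsub>M\<^esub> (N +>\<^bsub>M\<^esub> y) = N +>\<^bsub>M\<^esub> (x \<oplus>\<^bsub>M\<^esub> y)"
  using abelian_subgroup.a_rcos_sum[OF abelian_subgroup_submodule[OF assms(1)] assms(2,3)] .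

lemma coset_eq_iff:
  assumes N: "submodule N R M" and x: "x \<in> carrier M" and y: "y \<in> carrier M"
  shows "N +>\<^bsub>M\<^esub> x = N +>\<^bsub>M\<^esub> y \<longleftrightarrow> x \<oplus>\<^bsub>M\<^esub> \<ominus>\<^bsub>M\<^esub> y \<in> N"
proof -
  interpret abelian_subgroup N M
    by (rule abelian_subgroup_submodule[OF N])
  show ?thesis
    using x y a_rcos_module[OF y x] a_repr_independence'[of x y] a_rcos_self[OF x]
    by (metis M.abelian_group_axioms)
qed

lemma coset_eq_zero_iff:
  assumes N: "submodule N R M" and x: "x \<in> carrier M"
  shows "N +>\<^bsub>M\<^esub> x = N \<longleftrightarrow> x \<in> N"
proof -
  interpret abelian_subgroup N M
    by (rule abelian_subgroup_submodule[OF N])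
  show ?thesis
    using a_rcos_self[OF x] a_coset_join2[OF x] submodule.axioms(1)[OF N] by metis
qed

text \<open>The union in \<open>factor_module\<close> collapses: two representatives of a coset
  differ by some n in N, so their multiples differ by an, which lies in N, and all members of the
  union are equal.\<close>

lemma coset_smult:
  assumes N: "submodule N R M" and a: "a \<in> carrier R" and x: "x \<in> carrier M"
  shows "a \<odot>\<^bsub>factor_module M N\<^esub> (N +>\<^bsub>M\<^esub> x) = N +>\<^bsub>M\<^esub> (a \<odot>\<^bsub>M\<^esub> x)"
proof -
  interpret abelian_subgroup N M
    by (rule abelian_subgroup_submodule[OF N])
  have "N +>\<^bsub>M\<^esub> (a \<odot>\<^bsub>M\<^esub> y) = N +>\<^bsub>M\<^esub> (a \<odot>\<^bsub>M\<^esub> x)" if y: "y \<in> N +>\<^bsub>M\<^esub> x" for y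
  proof -
    obtain n where n: "n \<in> N" "y = n \<oplus>\<^bsub>M\<^esub> x"
      using y by (auto simp: a_r_coset_def')
    then have "y \<in> carrier M" "n \<in> carrier M"
      using submoduleD(1)[OF N] x by auto
    moreover have "a \<odot>\<^bsub>M\<^esub> y \<oplus>\<^bsub>M\<^esub> \<ominus>\<^bsub>M\<^esub> (a \<odot>\<^bsub>M\<^esub> x) = a \<odot>\<^bsub>M\<^esub> n"
      using n a x \<open>n \<in> carrier M\<close> by (simp add: smult_r_distr M.a_assoc M.r_neg)
    ultimately show ?thesis
      using coset_eq_iff[OF N, of "a \<odot>\<^bsub>M\<^esub> y" "a \<odot>\<^bsub>M\<^esub> x"] a x submoduleD(4)[OF N a n(1)] by simp
  qed
  then have "(\<Union>y\<in>N +>\<^bsub>M\<^esub> x. N +>\<^bsub>M\<^esub> (a \<odot>\<^bsub>M\<^esub> y)) = N +>\<^bsub>M\<^esub> (a \<odot>\<^bsub>M\<^esub> x)"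
    using a_rcos_self[OF x] by (intro SUP_eq_const) blast+
  then show ?thesis
    by (simp add: factor_module_def)
qed

lemma left_module_factor:
  assumes N: "submodule N R M"
  shows "left_module R (factor_module M N)"
proof -
  \<comment> \<open>The zero of the factor module is the set N itself; as the coset of zero it can
    enter \<open>coset_add\<close>.\<close>
  have N0: "N = N +>\<^bsub>M\<^esub> \<zero>\<^bsub>M\<^esub>"
    using submoduleD(1)[OF N] by (simp add: subsetI)
  have "abelian_group (factor_module M N)"
  proof (rule abelian_groupI)
    show "\<zero>\<^bsub>factor_module M N\<^esub> \<in> carrier (factor_module M N)"
      using N0 by (auto simp: carrier_factor_module)
  next
    fix A assume "A \<in> carrier (factor_module M N)"
    then obtain x where x: "x \<in> carrier M" "A = N +>\<^bsub>M\<^esub> x"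
      by (auto simp: carrier_factor_module)
    have "(N +>\<^bsub>M\<^esub> \<zero>\<^bsub>M\<^esub>) <+>\<^bsub>M\<^esub> A = A"
      unfolding x(2) coset_add[OF N M.zero_closed x(1)] using x(1) by simp
    then show "\<zero>\<^bsub>factor_module M N\<^esub> \<oplus>\<^bsub>factor_module M N\<^esub> A = A"
      using N0 by simp
    have "(N +>\<^bsub>M\<^esub> (\<ominus>\<^bsub>M\<^esub> x)) <+>\<^bsub>M\<^esub> A = N"
      unfolding x(2) coset_add[OF N M.a_inv_closed[OF x(1)] x(1)]
      using x(1) N0 by (simp add: M.l_neg)
    then show "\<exists>B\<in>carrier (factor_module M N). B \<oplus>\<^bsub>factor_module M N\<^esub> A = \<zero>\<^bsub>factor_module M N\<^esub>"
      using x(1) by (auto simp: carrier_factor_module)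
  next
    fix A B assume "A \<in> carrier (factor_module M N)" "B \<in> carrier (factor_module M N)"
    then obtain x y where xy: "x \<in> carrier M" "A = N +>\<^bsub>M\<^esub> x" "y \<in> carrier M" "B = N +>\<^bsub>M\<^esub> y"
      unfolding factor_module_simps carrier_factor_module by blast
    show "A \<oplus>\<^bsub>factor_module M N\<^esub> B \<in> carrier (factor_module M N)"
      using xy by (simp add: coset_add[OF N] carrier_factor_module)
    show "A \<oplus>\<^bsub>factor_module M N\<^esub> B = B \<oplus>\<^bsub>factor_module M N\<^esub> A"
      using xy by (simp add: coset_add[OF N] M.a_comm)
    fix C assume "C \<in> carrier (factor_module M N)"
    then obtain z where "z \<in> carrier M" "C = N +>\<^bsub>M\<^esub> z"
      unfolding factor_module_simps carrier_factor_module by blast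
    then show "A \<oplus>\<^bsub>factor_module M N\<^esub> B \<oplus>\<^bsub>factor_module M N\<^esub> C =
        A \<oplus>\<^bsub>factor_module M N\<^esub> (B \<oplus>\<^bsub>factor_module M N\<^esub> C)"
      using xy by (simp add: coset_add[OF N] M.a_assoc)
  qed
  then show ?thesis
    by (intro left_module.intro left_module_axioms.intro R.ring_axioms)
      (auto simp: carrier_factor_module coset_add[OF N] coset_smult[OF N] smult_l_distr
        smult_r_distr smult_assoc1)
qed

lemma coset_hom:
  assumes N: "submodule N R M"
  shows "(\<lambda>x. N +>\<^bsub>M\<^esub> x) \<in> left_module_hom R M (factor_module M N)"
  unfolding left_module_hom_def hom_def
  by (auto simp: carrier_factor_module coset_add[OF N] coset_smult[OF N])

text \<open>For \<open>N \<subseteq> P\<close> the canonical map \<open>M/N \<rightarrow> M/P\<close> sends a coset \<open>A\<close> of \<open>N\<close> to \<open>P + A\<close>.\<close>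

lemma set_add_coset:
  assumes N: "submodule N R M" and P: "submodule P R M" and "N \<subseteq> P" and x: "x \<in> carrier M"
  shows "P <+>\<^bsub>M\<^esub> (N +>\<^bsub>M\<^esub> x) = P +>\<^bsub>M\<^esub> x"
proof -
  note ND = submoduleD[OF N] and PD = submoduleD[OF P]
  have "p \<oplus>\<^bsub>M\<^esub> (n \<oplus>\<^bsub>M\<^esub> x) \<in> P +>\<^bsub>M\<^esub> x" if "p \<in> P" "n \<in> N" for p n
    using that \<open>N \<subseteq> P\<close> PD(1,3) x
    by (auto simp: a_r_coset_def' simp flip: M.a_assoc)
  moreover have "p \<oplus>\<^bsub>M\<^esub> x \<in> P <+>\<^bsub>M\<^esub> (N +>\<^bsub>M\<^esub> x)" if "p \<in> P" for p
  proof -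
    have "p \<oplus>\<^bsub>M\<^esub> x = p \<oplus>\<^bsub>M\<^esub> (\<zero>\<^bsub>M\<^esub> \<oplus>\<^bsub>M\<^esub> x)"
      using x by simp
    then show ?thesis
      unfolding a_r_coset_def' set_add_def' using that ND(2) by blast
  qed
  ultimately show ?thesis
    by (auto simp: a_r_coset_def' set_add_def')
qed

lemma set_add_hom:
  assumes N: "submodule N R M" and P: "submodule P R M" and NP: "N \<subseteq> P"
  shows "set_add M P \<in> left_module_hom R (factor_module M N) (factor_module M P)"
  unfolding left_module_hom_def hom_def
  by (auto simp: carrier_factor_module coset_add[OF N] coset_add[OF P] coset_smult[OF N]
      coset_smult[OF P] set_add_coset[OF N P NP])

text \<open>The common multiple criterion for M/P read on representatives: equality of cosets
  becomes a difference in P, and a nonzero coset becomes an element outside P.\<close>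

lemma uniform_factor_module_iff:
  assumes P: "submodule P R M"
  shows "uniform_module R (factor_module M P) \<longleftrightarrow> P \<noteq> carrier M \<and>
    (\<forall>x\<in>carrier M - P. \<forall>y\<in>carrier M - P.
      \<exists>a\<in>carrier R. \<exists>b\<in>carrier R. a \<odot>\<^bsub>M\<^esub> x \<oplus>\<^bsub>M\<^esub> \<ominus>\<^bsub>M\<^esub> (b \<odot>\<^bsub>M\<^esub> y) \<in> P \<and> a \<odot>\<^bsub>M\<^esub> x \<notin> P)"
proof -
  interpret Q: left_module R "factor_module M P"
    by (rule left_module_factor[OF P])
  have *: "carrier (factor_module M P) - {\<zero>\<^bsub>factor_module M P\<^esub>} = (\<lambda>x. P +>\<^bsub>M\<^esub> x) ` (carrier M - P)"
    using coset_eq_zero_iff[OF P] by (simp add: carrier_factor_module) blast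
  have "P = P +>\<^bsub>M\<^esub> \<zero>\<^bsub>M\<^esub>"
    using submoduleD(1)[OF P] by (simp add: subsetI)
  then have "P \<in> carrier (factor_module M P)"
    unfolding factor_module_simps carrier_factor_module using M.zero_closed by (rule image_eqI)
  then have nz: "carrier (factor_module M P) \<noteq> {\<zero>\<^bsub>factor_module M P\<^esub>} \<longleftrightarrow> P \<noteq> carrier M"
    using arg_cong[OF *, of "\<lambda>A. A = {}"] submoduleD(1)[OF P]
    unfolding image_is_empty factor_module_simps by blast
  have eq: "(a \<odot>\<^bsub>factor_module M P\<^esub> (P +>\<^bsub>M\<^esub> x) = b \<odot>\<^bsub>factor_module M P\<^esub> (P +>\<^bsub>M\<^esub> y) \<and>
      a \<odot>\<^bsub>factor_module M P\<^esub> (P +>\<^bsub>M\<^esub> x) \<noteq> \<zero>\<^bsub>factor_module M P\<^esub>) \<longleftrightarrow>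
    (a \<odot>\<^bsub>M\<^esub> x \<oplus>\<^bsub>M\<^esub> \<ominus>\<^bsub>M\<^esub> (b \<odot>\<^bsub>M\<^esub> y) \<in> P \<and> a \<odot>\<^bsub>M\<^esub> x \<notin> P)"
    if "a \<in> carrier R" "b \<in> carrier R" "x \<in> carrier M - P" "y \<in> carrier M - P" for a b x y
  proof -
    have "x \<in> carrier M" "y \<in> carrier M" "a \<odot>\<^bsub>M\<^esub> x \<in> carrier M" "b \<odot>\<^bsub>M\<^esub> y \<in> carrier M"
      using that by auto
    then show ?thesis
      by (simp only: factor_module_simps coset_smult[OF P] that coset_eq_zero_iff[OF P] coset_eq_iff[OF P])
  qed
  show ?thesis
    unfolding Q.uniform_module_iff nz * ball_simps
    by (simp only: eq cong: ball_cong bex_cong)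
qed

section \<open>Associated left primes of factor modules\<close>

text \<open>The submodule K/N of M/N is represented as the image of K under the coset map; an
  element of K outside N has a nonzero coset.\<close>

lemma nonzero_submodule_factor:
  assumes N: "submodule N R M" and K: "submodule K R M" and "N \<subseteq> K" "N \<noteq> K"
  shows "nonzero_submodule R (factor_module M N) ((\<lambda>x. N +>\<^bsub>M\<^esub> x) ` K)"
proof -
  obtain x where "x \<in> K" "x \<notin> N"
    using assms(3,4) by blast
  then have "N +>\<^bsub>M\<^esub> x \<noteq> N"
    using coset_eq_zero_iff[OF N] submoduleD(1)[OF K] by blast
  with \<open>x \<in> K\<close> show ?thesis
    unfolding nonzero_submodule_def
    using hom_image_submodule[OF left_module_axioms left_module_factor[OF N] coset_hom[OF N] K]
    by auto
qed

lemma associated_left_primes_factor_nonempty: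
  assumes N: "submodule N R M" and "N \<noteq> carrier M" and fin: "finite_uniform_dim R (factor_module M N)"
  shows "associated_left_primes R (factor_module M N) \<noteq> {}"
proof -
  interpret Q: left_module R "factor_module M N"
    by (rule left_module_factor[OF N])
  have "nonzero_submodule R (factor_module M N) ((\<lambda>x. N +>\<^bsub>M\<^esub> x) ` carrier M)"
    using nonzero_submodule_factor[OF N submodule_carrier] submoduleD(1)[OF N] assms(2) by blast
  from Q.contains_uniform_submodule[OF fin this] show ?thesis
    unfolding associated_left_primes_def by blast
qed

text \<open>A factor module by all of M is zero, whereas a uniform submodule is nonzero.\<close>

lemma associated_left_primes_factor_imp_proper:
  assumes "X \<in> associated_left_primes R (factor_module M N)" and N: "submodule N R M"
  shows "N \<noteq> carrier M"
proof
  interpret Q: left_module R "factor_module M N"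
    by (rule left_module_factor[OF N])
  assume "N = carrier M"
  then have "carrier (factor_module M N) \<subseteq> {N}"
    using coset_eq_zero_iff[OF N] by (auto simp: carrier_factor_module)
  moreover obtain U where "submodule U R (factor_module M N)" "U \<noteq> {N}"
    using assms(1) unfolding associated_left_primes_def uniform_module_def by auto
  ultimately show False
    using Q.submoduleD(1,2) by fastforce
qed

text \<open>Finitely many nonzero submodules of a uniform module have a common nonzero element. If a
  uniform U in M/N met every P i / N nontrivially, a nonzero coset would therefore lie in all of
  them, although they intersect in zero. So some canonical map M/N to M/P i is injective on
  U.\<close>

lemma associated_left_primes_Inter:
  assumes I: "finite I" "I \<noteq> {}" and P: "\<And>i. i \<in> I \<Longrightarrow> submodule (P i) R M"
    and N: "N = (\<Inter>i\<in>I. P i)"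
  shows "associated_left_primes R (factor_module M N) \<subseteq>
    (\<Union>i\<in>I. associated_left_primes R (factor_module M (P i)))"
proof
  fix X assume "X \<in> associated_left_primes R (factor_module M N)"
  then obtain U where X: "X = essential_class R ((factor_module M N)\<lparr>carrier := U\<rparr>)"
    and U: "submodule U R (factor_module M N)" "uniform_module R ((factor_module M N)\<lparr>carrier := U\<rparr>)"
    unfolding associated_left_primes_def by blast
  have Ns: "submodule N R M"
    using submodule_INT[OF I(2)] P unfolding N by blast
  have NP: "N \<subseteq> P i" if "i \<in> I" for i
    using that N by blast
  interpret Q: left_module R "factor_module M N"
    by (rule left_module_factor[OF Ns])
  note UD = Q.submoduleD[OF U(1)]
  have u: "U \<noteq> {N}" "\<And>x y. \<lbrakk>x \<in> U - {N}; y \<in> U - {N}\<rbrakk> \<Longrightarrow> \<exists>a\<in>carrier R. \<exists>b\<in>carrier R.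
      a \<odot>\<^bsub>factor_module M N\<^esub> x = b \<odot>\<^bsub>factor_module M N\<^esub> y \<and> a \<odot>\<^bsub>factor_module M N\<^esub> x \<noteq> N"
    using U Q.uniform_submodule_iff[OF U(1)] by auto
  have hom: "set_add M (P i) \<in> left_module_hom R (factor_module M N) (factor_module M (P i))"
    if "i \<in> I" for i
    using set_add_hom[OF Ns P[OF that] NP[OF that]] .
  have fact: "left_module R (factor_module M (P i))" if "i \<in> I" for i
    using left_module_factor[OF P[OF that]] .
  have smult_ker: "P i <+>\<^bsub>M\<^esub> (a \<odot>\<^bsub>factor_module M N\<^esub> A) = P i"
    if "i \<in> I" "a \<in> carrier R" "A \<in> U" "P i <+>\<^bsub>M\<^esub> A = P i" for i a A
    using left_module_homD(3)[OF hom[OF that(1)] that(2) UD(1)[OF that(3)]] that(4)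
      left_module.smult_r_null[OF fact[OF that(1)] that(2)] by simp
  have "\<exists>i\<in>I. \<forall>A\<in>U. P i <+>\<^bsub>M\<^esub> A = P i \<longrightarrow> A = N"
  proof (rule ccontr)
    assume "\<not> ?thesis"
    then have ker: "\<exists>A\<in>U - {N}. P i <+>\<^bsub>M\<^esub> A = P i" if "i \<in> I" for i
      using that by blast
    \<comment> \<open>Induction over the set J of kernels already met. For a new j, a common nonzero
      multiple of the old element A and of an element B of the j-th kernel lies in all kernels,
      since these are closed under scalars.\<close>
    have "\<exists>A\<in>U - {N}. \<forall>i\<in>J. P i <+>\<^bsub>M\<^esub> A = P i" if "finite J" "J \<subseteq> I" for J
      using that
    proof (induction J)
      case empty
      then show ?case
        using u(1) UD(2) by auto
    next
      case (insert j J)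
      then obtain A B where A: "A \<in> U - {N}" "\<forall>i\<in>J. P i <+>\<^bsub>M\<^esub> A = P i"
        and B: "B \<in> U - {N}" "P j <+>\<^bsub>M\<^esub> B = P j"
        using ker[of j] by auto
      obtain a b where ab: "a \<in> carrier R" "b \<in> carrier R"
        "a \<odot>\<^bsub>factor_module M N\<^esub> A = b \<odot>\<^bsub>factor_module M N\<^esub> B" "a \<odot>\<^bsub>factor_module M N\<^esub> A \<noteq> N"
        using u(2)[OF A(1) B(1)] by blast
      have "P i <+>\<^bsub>M\<^esub> (a \<odot>\<^bsub>factor_module M N\<^esub> A) = P i" if "i \<in> insert j J" for i
      proof (cases "i = j")
        case True
        then show ?thesis
          using smult_ker[of j b B] ab B insert.prems by simp
      next
        case False
        then show ?thesis
          using smult_ker[of i a A] ab A insert.prems that by auto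
      qed
      moreover have "a \<odot>\<^bsub>factor_module M N\<^esub> A \<in> U - {N}"
        using ab A UD(4) by blast
      ultimately show ?case
        by blast
    qed
    \<comment> \<open>A representative of this coset lies in every \<open>P i\<close>, hence in N,
      so the coset is zero after all.\<close>
    from this[OF I(1)] obtain A where A: "A \<in> U - {N}" "\<And>i. i \<in> I \<Longrightarrow> P i <+>\<^bsub>M\<^esub> A = P i"
      by blast
    then obtain x where x: "x \<in> carrier M" "A = N +>\<^bsub>M\<^esub> x"
      using UD(1)[of A] by (auto simp: carrier_factor_module)
    then have "x \<in> P i" if "i \<in> I" for i
      using A(2)[OF that] set_add_coset[OF Ns P[OF that] NP[OF that]] coset_eq_zero_iff[OF P[OF that]] that
      by simp
    then have "x \<in> N"
      using N by blast
    then show False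
      using A(1) x coset_eq_zero_iff[OF Ns] by simp
  qed
  then obtain i where i: "i \<in> I" "\<And>A. \<lbrakk>A \<in> U; P i <+>\<^bsub>M\<^esub> A = P i\<rbrakk> \<Longrightarrow> A = N"
    by blast
  have "inj_on (set_add M (P i)) U"
    using hom_inj_on[OF Q.left_module_axioms fact[OF i(1)] hom[OF i(1)] U(1)] i(2) by simp
  then have "X \<in> associated_left_primes R (factor_module M (P i))"
    unfolding X
    using associated_left_prime_hom_image[OF Q.left_module_axioms fact[OF i(1)] hom[OF i(1)] U] by blast
  then show "X \<in> (\<Union>i\<in>I. associated_left_primes R (factor_module M (P i)))"
    using i(1) by blast
qed

text \<open>K/N is nonzero and meets the kernel P/N of M/N to M/P trivially. A uniform submodule of
  K/N thus embeds into M/P, where its class can only be X.\<close>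

lemma associated_left_primes_subset_if_Int:
  assumes N: "submodule N R M" and P: "submodule P R M" and K: "submodule K R M"
    and "K \<inter> P = N" "K \<noteq> N" and fin: "finite_uniform_dim R (factor_module M N)"
    and X: "associated_left_primes R (factor_module M P) = {X}"
  shows "X \<in> associated_left_primes R (factor_module M N)"
proof -
  interpret Q: left_module R "factor_module M N"
    by (rule left_module_factor[OF N])
  have NP: "N \<subseteq> P" "N \<subseteq> K" "N \<noteq> K"
    using assms(4,5) by auto
  obtain U where U: "submodule U R (factor_module M N)" "U \<subseteq> (\<lambda>x. N +>\<^bsub>M\<^esub> x) ` K"
    "uniform_module R ((factor_module M N)\<lparr>carrier := U\<rparr>)"
    using Q.contains_uniform_submodule[OF fin nonzero_submodule_factor[OF N K NP(2,3)]] by blast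
  have "inj_on (set_add M P) U"
  proof (rule hom_inj_on[OF Q.left_module_axioms left_module_factor[OF P] set_add_hom[OF N P NP(1)] U(1)])
    fix A assume A: "A \<in> U" "P <+>\<^bsub>M\<^esub> A = \<zero>\<^bsub>factor_module M P\<^esub>"
    obtain x where x: "x \<in> K" "A = N +>\<^bsub>M\<^esub> x"
      using A U(2) by blast
    then have "x \<in> P"
      using A(2) set_add_coset[OF N P NP(1)] submoduleD(1)[OF K] coset_eq_zero_iff[OF P] by simp
    then show "A = \<zero>\<^bsub>factor_module M N\<^esub>"
      using x assms(4) coset_eq_zero_iff[OF N] submoduleD(1)[OF K] by auto
  qed
  then have "essential_class R ((factor_module M N)\<lparr>carrier := U\<rparr>)
    \<in> associated_left_primes R (factor_module M P)"
    using associated_left_prime_hom_image[OF Q.left_module_axioms left_module_factor[OF P]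
        set_add_hom[OF N P NP(1)] U(1,3)] by blast
  then have "essential_class R ((factor_module M N)\<lparr>carrier := U\<rparr>) = X"
    using X by blast
  then show ?thesis
    unfolding associated_left_primes_def using U by blast
qed

end

subsection \<open>Primary decompositions\<close>

context left_module
begin

section \<open>Existence of decompositions with uniform factors\<close>

text \<open>Zorn's lemma for the submodules meeting U exactly in N. One of them is N, as it lies in
  U, and the union of a nonempty chain of them is another.\<close>

lemma exists_maximal_complement:
  assumes N: "submodule N R M" and "N \<subseteq> U"
  shows "\<exists>P. submodule P R M \<and> P \<inter> U = N \<and>
    (\<forall>P'. submodule P' R M \<and> P \<subseteq> P' \<and> P' \<inter> U = N \<longrightarrow> P' = P)"
proof -
  let ?S = "{P. submodule P R M \<and> P \<inter> U = N}"
  have "\<exists>P\<in>?S. \<forall>P'\<in>?S. P \<subseteq> P' \<longrightarrow> P' = P"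
  proof (rule subset_Zorn_nonempty)
    show "?S \<noteq> {}"
      using assms by blast
    fix C assume C: "C \<noteq> {}" "subset.chain ?S C"
    have sub: "submodule P R M" "P \<inter> U = N" if "P \<in> C" for P
      using C(2) that unfolding subset.chain_def by auto
    have "submodule (\<Union>C) R M"
    proof (rule submoduleI)
      show "\<Union>C \<subseteq> carrier M" "\<zero>\<^bsub>M\<^esub> \<in> \<Union>C"
        using sub(1) submoduleD(1,2) C(1) by blast+
    next
      fix x y assume "x \<in> \<Union>C" "y \<in> \<Union>C"
      then obtain A B where AB: "A \<in> C" "B \<in> C" "x \<in> A" "y \<in> B"
        by blast
      then have "A \<subseteq> B \<or> B \<subseteq> A"
        using C(2) unfolding subset_chain_def by blast
      then show "x \<oplus>\<^bsub>M\<^esub> y \<in> \<Union>C"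
        using AB submoduleD(3)[OF sub(1)] by blast
    next
      fix a x assume "a \<in> carrier R" "x \<in> \<Union>C"
      then show "a \<odot>\<^bsub>M\<^esub> x \<in> \<Union>C"
        using submoduleD(4)[OF sub(1)] by blast
    qed
    moreover have "\<Union>C \<inter> U = N"
      using sub(2) C(1) by blast
    ultimately show "\<Union>C \<in> ?S"
      by blast
  qed
  then show ?thesis
    by blast
qed

text \<open>Maximality of \<open>P\<close> makes the image of \<open>U/N\<close> essential in \<open>M/P\<close>.\<close>

lemma uniform_factor_maximal_complement:
  assumes U: "submodule U R M" and P: "submodule P R M" and PU: "P \<inter> U = N" and "U \<noteq> N"
    and max: "\<And>P'. \<lbrakk>submodule P' R M; P \<subseteq> P'; P' \<inter> U = N\<rbrakk> \<Longrightarrow> P' = P"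
    and unif: "\<And>x y. \<lbrakk>x \<in> U - N; y \<in> U - N\<rbrakk> \<Longrightarrow> \<exists>a\<in>carrier R. \<exists>b\<in>carrier R.
      a \<odot>\<^bsub>M\<^esub> x \<oplus>\<^bsub>M\<^esub> \<ominus>\<^bsub>M\<^esub> (b \<odot>\<^bsub>M\<^esub> y) \<in> N \<and> a \<odot>\<^bsub>M\<^esub> x \<notin> N"
  shows "uniform_module R (factor_module M P)"
proof -
  note UD = submoduleD[OF U] and PD = submoduleD[OF P]
  \<comment> \<open>For x outside P the submodule P + Rx is strictly larger than P, so by maximality
    it meets U in more than N.\<close>
  have meet: "\<exists>u p a. u \<in> U - N \<and> p \<in> P \<and> a \<in> carrier R \<and> u = p \<oplus>\<^bsub>M\<^esub> a \<odot>\<^bsub>M\<^esub> x"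
    if x: "x \<in> carrier M - P" for x
  proof -
    let ?P' = "{p \<oplus>\<^bsub>M\<^esub> a \<odot>\<^bsub>M\<^esub> x | p a. p \<in> P \<and> a \<in> carrier R}"
    have "p \<in> ?P'" if "p \<in> P" for p
      using that x PD(1) by (intro CollectI exI[of _ p] exI[of _ "\<zero>"]) auto
    moreover have "x \<in> ?P'"
      using x PD(2) by (intro CollectI exI[of _ "\<zero>\<^bsub>M\<^esub>"] exI[of _ "\<one>"]) auto
    ultimately have "?P' \<inter> U \<noteq> N" "N \<subseteq> ?P' \<inter> U"
      using max[OF submodule_add_cyclic[OF P]] x PU by blast+
    then show ?thesis
      by blast
  qed
  show ?thesis
    unfolding uniform_factor_module_iff[OF P]
  proof (intro conjI ballI)
    show "P \<noteq> carrier M"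
      using PU \<open>U \<noteq> N\<close> UD(1) by blast
    fix x y assume x: "x \<in> carrier M - P" and y: "y \<in> carrier M - P"
    obtain u p a where u: "u \<in> U - N" "p \<in> P" "a \<in> carrier R" "u = p \<oplus>\<^bsub>M\<^esub> a \<odot>\<^bsub>M\<^esub> x"
      using meet[OF x] by blast
    obtain v q b where v: "v \<in> U - N" "q \<in> P" "b \<in> carrier R" "v = q \<oplus>\<^bsub>M\<^esub> b \<odot>\<^bsub>M\<^esub> y"
      using meet[OF y] by blast
    \<comment> \<open>Modulo P the elements u and v are ax and by. A common multiple of u and v
      modulo N therefore gives one of x and y modulo P, with coefficients ca and db.\<close>
    obtain c d where cd: "c \<in> carrier R" "d \<in> carrier R"
      "c \<odot>\<^bsub>M\<^esub> u \<oplus>\<^bsub>M\<^esub> \<ominus>\<^bsub>M\<^esub> (d \<odot>\<^bsub>M\<^esub> v) \<in> N" "c \<odot>\<^bsub>M\<^esub> u \<notin> N"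
      using unif[OF u(1) v(1)] by blast
    have car: "p \<in> carrier M" "q \<in> carrier M" "x \<in> carrier M" "y \<in> carrier M"
      using u v x y PD(1) by auto
    have cu: "c \<odot>\<^bsub>M\<^esub> u = c \<odot>\<^bsub>M\<^esub> p \<oplus>\<^bsub>M\<^esub> (c \<otimes> a) \<odot>\<^bsub>M\<^esub> x"
      using u cd car by (simp add: smult_r_distr smult_assoc1)
    have dv: "d \<odot>\<^bsub>M\<^esub> v = d \<odot>\<^bsub>M\<^esub> q \<oplus>\<^bsub>M\<^esub> (d \<otimes> b) \<odot>\<^bsub>M\<^esub> y"
      using v cd car by (simp add: smult_r_distr smult_assoc1)
    let ?x = "(c \<otimes> a) \<odot>\<^bsub>M\<^esub> x" and ?y = "(d \<otimes> b) \<odot>\<^bsub>M\<^esub> y"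
      and ?p = "c \<odot>\<^bsub>M\<^esub> p" and ?q = "d \<odot>\<^bsub>M\<^esub> q"
    have P': "?p \<in> P" "?q \<in> P" "?p \<in> carrier M" "?q \<in> carrier M" "?x \<in> carrier M" "?y \<in> carrier M"
      using PD(4) u v cd car by auto
    have "(P +>\<^bsub>M\<^esub> ?x) = P +>\<^bsub>M\<^esub> (c \<odot>\<^bsub>M\<^esub> u)" "(P +>\<^bsub>M\<^esub> ?y) = P +>\<^bsub>M\<^esub> (d \<odot>\<^bsub>M\<^esub> v)"
      unfolding cu dv using P' PD(1) a_coset_join2[of ?p P] a_coset_join2[of ?q P] submodule.axioms(1)[OF P]
      by (simp_all add: subsetI flip: a_coset_add_assoc)
    moreover have "P +>\<^bsub>M\<^esub> (c \<odot>\<^bsub>M\<^esub> u) = P +>\<^bsub>M\<^esub> (d \<odot>\<^bsub>M\<^esub> v)"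
      using cd(3) PU coset_eq_iff[OF P] UD(1) UD(4)[OF cd(1)] UD(4)[OF cd(2)] u(1) v(1) by blast
    ultimately have "?x \<oplus>\<^bsub>M\<^esub> \<ominus>\<^bsub>M\<^esub> ?y \<in> P"
      using coset_eq_iff[OF P P'(5,6)] by simp
    \<comment> \<open>Otherwise cu would lie in both P and U, hence in N.\<close>
    moreover have "?x \<notin> P"
      using cd(4) PD(3)[OF P'(1)] UD(4)[OF cd(1), of u] u(1) PU unfolding cu by blast
    ultimately show "\<exists>a\<in>carrier R. \<exists>b\<in>carrier R. a \<odot>\<^bsub>M\<^esub> x \<oplus>\<^bsub>M\<^esub> \<ominus>\<^bsub>M\<^esub> (b \<odot>\<^bsub>M\<^esub> y) \<in> P \<and> a \<odot>\<^bsub>M\<^esub> x \<notin> P"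
      using u(3) v(3) cd(1,2) by blast
  qed
qed

text \<open>One step of the construction: a uniform V inside K/N, its preimage U in M, and a maximal
  P meeting U in N. Since N lies in K, the preimage stays inside K.\<close>

lemma exists_uniform_factor:
  assumes N: "submodule N R M" and K: "submodule K R M" and NK: "N \<subseteq> K" "N \<noteq> K"
    and fin: "finite_uniform_dim R (factor_module M N)"
  shows "\<exists>U P. submodule U R M \<and> submodule P R M \<and> uniform_module R (factor_module M P) \<and>
    U \<subseteq> K \<and> U \<noteq> N \<and> P \<inter> U = N"
proof -
  interpret Q: left_module R "factor_module M N"
    by (rule left_module_factor[OF N])
  obtain V where V: "submodule V R (factor_module M N)" "V \<subseteq> (\<lambda>x. N +>\<^bsub>M\<^esub> x) ` K"
    "uniform_module R ((factor_module M N)\<lparr>carrier := V\<rparr>)"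
    using Q.contains_uniform_submodule[OF fin nonzero_submodule_factor[OF N K NK]] by blast
  define U where "U = {x \<in> carrier M. N +>\<^bsub>M\<^esub> x \<in> V}"
  have U: "submodule U R M"
    unfolding U_def
    by (rule hom_vimage_submodule[OF left_module_axioms left_module_factor[OF N] coset_hom[OF N] V(1)])
  have NU: "N \<subseteq> U"
  proof
    fix x assume x: "x \<in> N"
    then have xc: "x \<in> carrier M"
      by (rule submoduleD(1)[OF N])
    then show "x \<in> U"
      using x coset_eq_zero_iff[OF N xc] Q.submoduleD(2)[OF V(1)] by (simp add: U_def)
  qed
  have v: "V \<noteq> {N}" "\<And>x y. \<lbrakk>x \<in> V - {N}; y \<in> V - {N}\<rbrakk> \<Longrightarrow> \<exists>a\<in>carrier R. \<exists>b\<in>carrier R.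
      a \<odot>\<^bsub>factor_module M N\<^esub> x = b \<odot>\<^bsub>factor_module M N\<^esub> y \<and> a \<odot>\<^bsub>factor_module M N\<^esub> x \<noteq> N"
    using V Q.uniform_submodule_iff[OF V(1)] by auto
  have "U \<subseteq> K"
  proof
    fix x assume "x \<in> U"
    then obtain k where k: "k \<in> K" "N +>\<^bsub>M\<^esub> x = N +>\<^bsub>M\<^esub> k" and x: "x \<in> carrier M"
      using V(2) by (auto simp: U_def)
    have kc: "k \<in> carrier M"
      using k(1) submoduleD(1)[OF K] by blast
    then have "x \<oplus>\<^bsub>M\<^esub> \<ominus>\<^bsub>M\<^esub> k \<in> K"
      using k(2) coset_eq_iff[OF N x] NK(1) by blast
    then have "(x \<oplus>\<^bsub>M\<^esub> \<ominus>\<^bsub>M\<^esub> k) \<oplus>\<^bsub>M\<^esub> k \<in> K"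
      using submoduleD(3)[OF K] k(1) by blast
    then show "x \<in> K"
      using x kc by (simp add: M.a_assoc M.l_neg)
  qed
  moreover have "U \<noteq> N"
  proof
    assume "U = N"
    obtain A where A: "A \<in> V" "A \<noteq> N"
      using v(1) Q.submoduleD(2)[OF V(1)] by auto
    then obtain x where x: "x \<in> K" "A = N +>\<^bsub>M\<^esub> x"
      using V(2) by blast
    then have xc: "x \<in> carrier M"
      using submoduleD(1)[OF K] by blast
    then have "x \<in> N"
      using A(1) x(2) \<open>U = N\<close> by (auto simp: U_def)
    then show False
      using A(2) x(2) coset_eq_zero_iff[OF N xc] by blast
  qed
  moreover from exists_maximal_complement[OF N NU] obtain P where P: "submodule P R M" "P \<inter> U = N"
    and max: "\<forall>P'. submodule P' R M \<and> P \<subseteq> P' \<and> P' \<inter> U = N \<longrightarrow> P' = P"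
    by (elim exE conjE)
  moreover have "uniform_module R (factor_module M P)"
  proof (rule uniform_factor_maximal_complement[OF U P \<open>U \<noteq> N\<close>])
    show "P' = P" if "submodule P' R M" "P \<subseteq> P'" "P' \<inter> U = N" for P'
      using max that by simp
  next
    fix x y assume "x \<in> U - N" "y \<in> U - N"
    then have xy: "x \<in> carrier M" "y \<in> carrier M" "N +>\<^bsub>M\<^esub> x \<in> V - {N}" "N +>\<^bsub>M\<^esub> y \<in> V - {N}"
      using coset_eq_zero_iff[OF N] by (simp_all add: U_def)
    obtain a b where ab: "a \<in> carrier R" "b \<in> carrier R"
      "a \<odot>\<^bsub>factor_module M N\<^esub> (N +>\<^bsub>M\<^esub> x) = b \<odot>\<^bsub>factor_module M N\<^esub> (N +>\<^bsub>M\<^esub> y)"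
      "a \<odot>\<^bsub>factor_module M N\<^esub> (N +>\<^bsub>M\<^esub> x) \<noteq> N"
      using v(2)[OF xy(3,4)] by blast
    have "a \<odot>\<^bsub>M\<^esub> x \<in> carrier M" "b \<odot>\<^bsub>M\<^esub> y \<in> carrier M"
      using ab xy by auto
    then have "a \<odot>\<^bsub>M\<^esub> x \<oplus>\<^bsub>M\<^esub> \<ominus>\<^bsub>M\<^esub> (b \<odot>\<^bsub>M\<^esub> y) \<in> N" "a \<odot>\<^bsub>M\<^esub> x \<notin> N"
      using ab xy coset_smult[OF N] coset_eq_iff[OF N] coset_eq_zero_iff[OF N] by simp_all
    then show "\<exists>a\<in>carrier R. \<exists>b\<in>carrier R. a \<odot>\<^bsub>M\<^esub> x \<oplus>\<^bsub>M\<^esub> \<ominus>\<^bsub>M\<^esub> (b \<odot>\<^bsub>M\<^esub> y) \<in> N \<and> a \<odot>\<^bsub>M\<^esub> x \<notin> N"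
      using ab by blast
  qed
  ultimately show ?thesis
    using U by blast
qed

text \<open>Intersecting with the carrier covers an empty index set, whose intersection is then M
  itself.\<close>

lemma submodule_carrier_INT:
  "(\<And>i. i \<in> I \<Longrightarrow> submodule (P i) R M) \<Longrightarrow> submodule (carrier M \<inter> (\<Inter>i\<in>I. P i)) R M"
  by (rule submoduleI) (auto dest: submoduleD)

text \<open>If no finite family worked, every finite intersection reached would stay strictly above
  N and the choice of further U and P could go on forever. The images of the chosen U in M/N would
  then form an infinite direct sum.\<close>

lemma exists_uniform_decomposition:
  assumes N: "submodule N R M" and "N \<noteq> carrier M" and fin: "finite_uniform_dim R (factor_module M N)"
  shows "\<exists>\<A>. finite \<A> \<and> \<A> \<noteq> {} \<and> N = \<Inter>\<A> \<and>
    (\<forall>P\<in>\<A>. submodule P R M \<and> uniform_module R (factor_module M P))"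
proof (rule ccontr)
  assume none: "\<not> ?thesis"
  \<comment> \<open>These are the intermediate stages: finite intersections, containing N, of
    submodules with uniform factor. The empty family gives M, the start of the construction.\<close>
  define good where "good K \<longleftrightarrow> N \<subseteq> K \<and> (\<exists>\<A>. finite \<A> \<and> K = carrier M \<inter> \<Inter>\<A> \<and>
    (\<forall>P\<in>\<A>. submodule P R M \<and> uniform_module R (factor_module M P)))" for K
  have good_sub: "submodule K R M" if "good K" for K
    using that submodule_carrier_INT[of _ "\<lambda>P. P"] unfolding good_def by auto
  \<comment> \<open>A stage equal to N would be the excluded decomposition; its family is nonempty
    because N is not M.\<close>
  have good_ne: "N \<noteq> K" if K: "good K" for K
  proof
    assume "N = K"
    obtain \<A> where \<A>: "finite \<A>" "K = carrier M \<inter> \<Inter>\<A>"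
      "\<forall>P\<in>\<A>. submodule P R M \<and> uniform_module R (factor_module M P)"
      using K unfolding good_def by blast
    show False
    proof (cases "\<A> = {}")
      case True
      then show ?thesis
        using \<A>(2) \<open>N = K\<close> assms(2) by simp
    next
      case False
      then have "\<Inter>\<A> \<subseteq> carrier M"
        using \<A>(3) submoduleD(1) by blast
      then have "N = \<Inter>\<A>"
        using \<A>(2) \<open>N = K\<close> by blast
      then show ?thesis
        using none \<A> False by blast
    qed
  qed
  have step: "\<exists>U K'. submodule U R M \<and> U \<noteq> N \<and> U \<inter> K' = N \<and> U \<subseteq> K \<and> good K' \<and> K' \<subseteq> K"
    if K: "good K" for K
  proof -
    have "N \<subseteq> K"
      using K by (simp add: good_def)
    then obtain U P where UP: "submodule U R M" "submodule P R M" "uniform_module R (factor_module M P)"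
      "U \<subseteq> K" "U \<noteq> N" "P \<inter> U = N"
      using exists_uniform_factor[OF N good_sub[OF K] _ good_ne[OF K] fin] by blast
    obtain \<A> where "finite \<A>" "K = carrier M \<inter> \<Inter>\<A>"
      "\<forall>P\<in>\<A>. submodule P R M \<and> uniform_module R (factor_module M P)"
      using K unfolding good_def by blast
    then have "good (K \<inter> P)"
      unfolding good_def using UP \<open>N \<subseteq> K\<close> by (intro conjI exI[of _ "insert P \<A>"]) auto
    moreover have "U \<inter> (K \<inter> P) = N"
      using UP by blast
    ultimately show ?thesis
      using UP by blast
  qed
  define S where "S p \<longleftrightarrow> submodule (fst p) R M \<and> fst p \<noteq> N \<and> fst p \<inter> snd p = N \<and> good (snd p)"
    for p :: "'a set \<times> 'a set"
  have "good (carrier M)"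
    unfolding good_def using submoduleD(1)[OF N] by (intro conjI exI[of _ "{}"]) auto
  from step[OF this] have ex: "\<exists>p. S p"
    by (auto simp: S_def)
  have next_ex: "\<exists>q. S q \<and> fst q \<subseteq> snd p \<and> snd q \<subseteq> snd p" if p: "S p" for p
  proof -
    have "good (snd p)"
      using p by (simp add: S_def)
    from step[OF this] show ?thesis
      by (auto simp: S_def)
  qed
  have "\<exists>s. \<forall>n. S (s n) \<and> fst (s (Suc n)) \<subseteq> snd (s n) \<and> snd (s (Suc n)) \<subseteq> snd (s n)"
    by (rule dependent_nat_choice) (use ex next_ex in blast)+
  then obtain s where s: "\<And>n. S (s n)"
    "\<And>n. fst (s (Suc n)) \<subseteq> snd (s n)" "\<And>n. snd (s (Suc n)) \<subseteq> snd (s n)"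
    by blast
  interpret Q: left_module R "factor_module M N"
    by (rule left_module_factor[OF N])
  let ?\<pi> = "\<lambda>x. N +>\<^bsub>M\<^esub> x"
  have sub: "submodule (fst (s n)) R M" "submodule (snd (s n)) R M"
    "fst (s n) \<inter> snd (s n) = N" "N \<noteq> fst (s n)" for n
    using s(1)[of n] good_sub by (auto simp: S_def)
  have "\<not> finite_uniform_dim R (factor_module M N)"
  proof (rule Q.not_finite_uniform_dimI[of "\<lambda>n. ?\<pi> ` fst (s n)" "\<lambda>n. ?\<pi> ` snd (s n)"])
    fix n
    show "nonzero_submodule R (factor_module M N) (?\<pi> ` fst (s n))"
      using nonzero_submodule_factor[OF N sub(1) _ sub(4)] sub(3) by blast
    show "submodule (?\<pi> ` snd (s n)) R (factor_module M N)"
      using hom_image_submodule[OF left_module_axioms Q.left_module_axioms coset_hom[OF N] sub(2)] .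
    show "?\<pi> ` fst (s (Suc n)) \<subseteq> ?\<pi> ` snd (s n)" "?\<pi> ` snd (s (Suc n)) \<subseteq> ?\<pi> ` snd (s n)"
      using s(2,3) by (intro image_mono; blast)+
    \<comment> \<open>Both components contain N, so equal cosets put x into the second component as
      well; then x lies in the intersection N and its coset is zero.\<close>
    have "?\<pi> x = N" if x: "x \<in> fst (s n)" and y: "y \<in> snd (s n)" and eq: "?\<pi> x = ?\<pi> y" for x y
    proof -
      have xc: "x \<in> carrier M" and yc: "y \<in> carrier M"
        using x y submoduleD(1)[OF sub(1)] submoduleD(1)[OF sub(2)] by auto
      have "x \<oplus>\<^bsub>M\<^esub> \<ominus>\<^bsub>M\<^esub> y \<in> snd (s n)"
        using eq coset_eq_iff[OF N xc yc] sub(3) by blast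
      then have "(x \<oplus>\<^bsub>M\<^esub> \<ominus>\<^bsub>M\<^esub> y) \<oplus>\<^bsub>M\<^esub> y \<in> snd (s n)"
        using submoduleD(3)[OF sub(2)] y by blast
      then have "x \<in> snd (s n)"
        using xc yc by (simp add: M.a_assoc M.l_neg)
      then show ?thesis
        using x sub(3) coset_eq_zero_iff[OF N xc] by blast
    qed
    moreover have "N \<in> ?\<pi> ` fst (s n)" "N \<in> ?\<pi> ` snd (s n)"
      using Q.submoduleD(2)[OF hom_image_submodule[OF left_module_axioms Q.left_module_axioms coset_hom[OF N]]]
        sub(1,2) by auto
    ultimately show "?\<pi> ` fst (s n) \<inter> ?\<pi> ` snd (s n) = {\<zero>\<^bsub>factor_module M N\<^esub>}"
      unfolding factor_module_simps by blast
  qed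
  then show False
    using fin by blast
qed

lemma primary_submodule_if_uniform_factor:
  assumes "submodule P R M" "finite_uniform_dim R (factor_module M P)"
    "uniform_module R (factor_module M P)"
  shows "primary_submodule R M P"
  using assms associated_left_primes_uniform unfolding primary_submodule_def by blast

end

section \<open>Numbering and length of decompositions\<close>

text \<open>A bijection from \<open>{1..card \<A>}\<close> numbers the components, so decompositions
  can be built as finite sets.\<close>

lemma primary_decomposition_of_finite_set:
  assumes "finite \<A>" "\<A> \<noteq> {}" "\<And>P. P \<in> \<A> \<Longrightarrow> primary_submodule R M P" "N = \<Inter>\<A>"
  shows "\<exists>Q. primary_decomposition R M N (card \<A>) Q"
proof -
  obtain Q where "bij_betw Q {1..card \<A>} \<A>"
    using ex_bij_betw_nat_finite_1[OF assms(1)] by blast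
  then have im: "Q ` {1..card \<A>} = \<A>"
    by (simp add: bij_betw_def)
  have "card \<A> \<ge> 1"
    using assms(1,2) by (simp add: Suc_le_eq card_gt_0_iff)
  moreover have "primary_submodule R M (Q i)" if "i \<in> {1..card \<A>}" for i
    using im that assms(3) by blast
  moreover have "N = (\<Inter>i\<in>{1..card \<A>}. Q i)"
    unfolding im by (rule assms(4))
  ultimately show ?thesis
    unfolding primary_decomposition_def by blast
qed

text \<open>Competitors of a shortest decomposition are measured as sets: components that coincide
  are counted once, which only sharpens the bound.\<close>

lemma shortest_primary_decompositionD:
  assumes "shortest_primary_decomposition R M N s P"
    and "finite \<A>" "\<A> \<noteq> {}" "\<And>A. A \<in> \<A> \<Longrightarrow> primary_submodule R M A" "N = \<Inter>\<A>"
  shows "s \<le> card \<A>"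
proof (rule ccontr)
  assume "\<not> s \<le> card \<A>"
  moreover have "\<exists>Q. primary_decomposition R M N (card \<A>) Q"
    using primary_decomposition_of_finite_set assms(2-5) by blast
  ultimately show False
    using assms(1) unfolding shortest_primary_decomposition_def by (meson not_le)
qed

lemma primary_decompositionD:
  assumes "primary_decomposition R M N s P"
  shows "s \<ge> 1" "i \<in> {1..s} \<Longrightarrow> primary_submodule R M (P i)" "i \<in> {1..s} \<Longrightarrow> submodule (P i) R M"
    "N = (\<Inter>i\<in>{1..s}. P i)"
  using assms unfolding primary_decomposition_def primary_submodule_def by blast+

context left_module
begin

lemma primary_decomposition_exists:
  assumes uf: "uniformly_finite R M" and N: "submodule N R M" and "N \<noteq> carrier M"
  shows "\<exists>s P. primary_decomposition R M N s P"
proof -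
  have fin: "finite_uniform_dim R (factor_module M P)" if "submodule P R M" for P
    using uf that by (simp add: uniformly_finite_def)
  obtain \<A> where \<A>: "finite \<A>" "\<A> \<noteq> {}" "N = \<Inter>\<A>"
    "\<And>P. P \<in> \<A> \<Longrightarrow> submodule P R M \<and> uniform_module R (factor_module M P)"
    using exists_uniform_decomposition[OF N assms(3) fin[OF N]] by blast
  then show ?thesis
    using primary_decomposition_of_finite_set[OF \<A>(1,2) _ \<A>(3)]
      primary_submodule_if_uniform_factor fin by blast
qed

text \<open>The factor by the intersection has no prime other than X by
  \<open>associated_left_primes_Inter\<close>, and has at least one because the intersection is
  proper.\<close>

lemma primary_submodule_Int:
  assumes fin: "finite_uniform_dim R (factor_module M (P \<inter> Q))"
    and P: "submodule P R M" "associated_left_primes R (factor_module M P) = {X}"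
    and Q: "submodule Q R M" "associated_left_primes R (factor_module M Q) = {X}"
  shows "primary_submodule R M (P \<inter> Q)"
proof -
  have PQ: "submodule (P \<inter> Q) R M"
    using P Q by (intro submodule_Int)
  have "P \<noteq> carrier M"
    using associated_left_primes_factor_imp_proper[of X P] P by simp
  then have "P \<inter> Q \<noteq> carrier M"
    using submoduleD(1)[OF P(1)] by blast
  then have "associated_left_primes R (factor_module M (P \<inter> Q)) \<noteq> {}"
    using associated_left_primes_factor_nonempty[OF PQ _ fin] by blast
  moreover have "associated_left_primes R (factor_module M (P \<inter> Q)) \<subseteq> {X}"
    using associated_left_primes_Inter[of "{P, Q}" "\<lambda>A. A" "P \<inter> Q"] P Q by auto
  ultimately show ?thesis
    unfolding primary_submodule_def using PQ fin by blast
qed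

text \<open>For each i, the intersection K of the other components is different from N, yet meets
  \<open>P i\<close> in N; so \<open>associated_left_primes_subset_if_Int\<close> applies.\<close>

lemma irredundant_associated_left_primes:
  assumes N: "submodule N R M" and fin: "finite_uniform_dim R (factor_module M N)"
    and dec: "primary_decomposition R M N s P"
    and X: "\<And>i. i \<in> {1..s} \<Longrightarrow> associated_left_primes R (factor_module M (P i)) = {X i}"
    and irr: "irredundant_intersection M s P"
  shows "X ` {1..s} \<subseteq> associated_left_primes R (factor_module M N)"
proof (intro image_subsetI)
  fix i assume i: "i \<in> {1..s}"
  let ?K = "carrier M \<inter> (\<Inter>j\<in>{1..s} - {i}. P j)"
  have Nall: "carrier M \<inter> (\<Inter>j\<in>{1..s}. P j) = N"
    using primary_decompositionD(4)[OF dec] submoduleD(1)[OF N] by blast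
  have "?K \<inter> P i = carrier M \<inter> (\<Inter>j\<in>{1..s}. P j)"
    using i by blast
  then have "?K \<inter> P i = N"
    using Nall by simp
  moreover have "?K \<noteq> N"
    using irr i Nall unfolding irredundant_intersection_def by auto
  moreover have "submodule ?K R M"
    using primary_decompositionD(3)[OF dec] by (intro submodule_carrier_INT) blast
  ultimately show "X i \<in> associated_left_primes R (factor_module M N)"
    using associated_left_primes_subset_if_Int[OF N primary_decompositionD(3)[OF dec i] _ _ _ fin X[OF i]]
    by blast
qed

lemma shortest_imp_irredundant:
  assumes N: "submodule N R M" "N \<noteq> carrier M"
    and short: "shortest_primary_decomposition R M N s P"
  shows "irredundant_intersection M s P"
  unfolding irredundant_intersection_def
proof (intro ballI notI)
  fix i assume i: "i \<in> {1..s}"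
    and eq: "carrier M \<inter> (\<Inter>j\<in>{1..s} - {i}. P j) = carrier M \<inter> (\<Inter>j\<in>{1..s}. P j)"
  have dec: "primary_decomposition R M N s P"
    using short by (simp add: shortest_primary_decomposition_def)
  have Nall: "carrier M \<inter> (\<Inter>j\<in>{1..s}. P j) = N"
    using primary_decompositionD(4)[OF dec] submoduleD(1)[OF N(1)] by blast
  \<comment> \<open>Some component remains: dropping the only one would leave the empty intersection
    M, which is not N.\<close>
  have ne: "{1..s} - {i} \<noteq> {}"
    using eq Nall N(2) by auto
  then have "(\<Inter>j\<in>{1..s} - {i}. P j) \<subseteq> carrier M"
    using primary_decompositionD(3)[OF dec] submoduleD(1) by blast
  then have "N = \<Inter>(P ` ({1..s} - {i}))"
    using eq Nall by blast
  then have "s \<le> card (P ` ({1..s} - {i}))"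
    using primary_decompositionD(2)[OF dec] ne
    by (intro shortest_primary_decompositionD[OF short]) auto
  also have "\<dots> \<le> card ({1..s} - {i})"
    by (rule card_image_le) simp
  also have "\<dots> = s - 1"
    using i by simp
  finally show False
    using primary_decompositionD(1)[OF dec] by simp
qed

text \<open>Two components with the same prime can be replaced by their intersection, which is again
  primary; this saves a term.\<close>

lemma shortest_imp_inj_on:
  assumes uf: "uniformly_finite R M" and short: "shortest_primary_decomposition R M N s P"
    and X: "\<And>i. i \<in> {1..s} \<Longrightarrow> associated_left_primes R (factor_module M (P i)) = {X i}"
  shows "inj_on X {1..s}"
proof (rule inj_onI, rule ccontr)
  fix i j assume ij: "i \<in> {1..s}" "j \<in> {1..s}" "X i = X j" "i \<noteq> j"
  have dec: "primary_decomposition R M N s P"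
    using short by (simp add: shortest_primary_decomposition_def)
  note D = primary_decompositionD[OF dec]
  let ?A = "insert (P i \<inter> P j) (P ` ({1..s} - {i, j}))"
  have "primary_submodule R M (P i \<inter> P j)"
    using primary_submodule_Int[of "P i" "P j" "X i"] X[OF ij(1)] X[OF ij(2)] ij(3) D(3) ij(1,2) uf
      submodule_Int[of "P i" "P j"] by (simp add: uniformly_finite_def)
  then have "primary_submodule R M A" if "A \<in> ?A" for A
    using that D(2) by blast
  moreover have "N = \<Inter>?A"
    unfolding D(4) using ij by auto
  ultimately have "s \<le> card ?A"
    by (intro shortest_primary_decompositionD[OF short]) auto
  also have "\<dots> \<le> Suc (card (P ` ({1..s} - {i, j})))"
    by (rule card_insert_le_m1) auto
  also have "\<dots> \<le> Suc (card ({1..s} - {i, j}))"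
    using card_image_le[of "{1..s} - {i, j}" P] by simp
  also have "\<dots> = Suc (s - 2)"
    using ij by (simp add: card_Diff_subset)
  finally have "s \<le> Suc (s - 2)" .
  \<comment> \<open>Two distinct indices exist, so the subtraction s - 2 is not truncated and the
    bound says s \<le> s - 1.\<close>
  moreover have "s \<ge> 2"
    using ij by auto
  ultimately show False
    by simp
qed

end

text \<open>The function X names the prime of each component. In the last clause finiteness
  accompanies the cardinality because \<open>card\<close> is 0 on infinite sets.\<close>

theorem theorem4p4:
  fixes R :: "('r, 'k) ring_scheme" and M :: "('r, 'a, 'm) module_scheme" and N :: "'a set"
  assumes "left_module R M"
    and "carrier M \<noteq> {\<zero>\<^bsub>M\<^esub>}"
    and "uniformly_finite R M"
    and "submodule N R M"
    and "N \<noteq> carrier M"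
  shows "(\<exists>s P. primary_decomposition R M N s P) \<and>
    (\<forall>s P X.
      primary_decomposition R M N s P \<and>
      (\<forall>i\<in>{1..s}. associated_left_primes R (factor_module M (P i)) = {X i}) \<longrightarrow>
        (associated_left_primes R (factor_module M N)
            \<subseteq> (\<Union>i\<in>{1..s}. associated_left_primes R (factor_module M (P i))) \<and>
         (\<Union>i\<in>{1..s}. associated_left_primes R (factor_module M (P i))) = X ` {1..s}) \<and>
        (irredundant_intersection M s P \<longrightarrow>
          associated_left_primes R (factor_module M N)
            = (\<Union>i\<in>{1..s}. associated_left_primes R (factor_module M (P i)))) \<and>
        (shortest_primary_decomposition R M N s P \<longrightarrow>
          (\<forall>Y\<in>associated_left_primes R (factor_module M N). \<exists>!i. i \<in> {1..s} \<and> Y = X i))) \<and>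
    (\<forall>r L.
      primary_decomposition R M N r L \<longrightarrow>
        (shortest_primary_decomposition R M N r L \<longleftrightarrow>
          finite (associated_left_primes R (factor_module M N)) \<and>
          r = card (associated_left_primes R (factor_module M N))))"
proof -
  interpret left_module R M by fact
  let ?As = "\<lambda>P. associated_left_primes R (factor_module M P)"
  have fin: "finite_uniform_dim R (factor_module M N)"
    using assms(3,4) by (simp add: uniformly_finite_def)
  have sub: "?As N \<subseteq> X ` {1..s}"
    if dec: "primary_decomposition R M N s P" and X: "\<forall>i\<in>{1..s}. ?As (P i) = {X i}" for s P X
  proof -
    have "?As N \<subseteq> (\<Union>i\<in>{1..s}. ?As (P i))"
      using primary_decompositionD[OF dec] by (intro associated_left_primes_Inter) auto
    then show ?thesis
      using X by auto
  qed
  have irr: "?As N = X ` {1..s}"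
    if dec: "primary_decomposition R M N s P" and X: "\<forall>i\<in>{1..s}. ?As (P i) = {X i}"
      and "irredundant_intersection M s P" for s P X
    using irredundant_associated_left_primes[OF assms(4) fin dec _ that(3), of X] X sub[OF dec X] by auto
  have short: "?As N = X ` {1..s}" "inj_on X {1..s}"
    if X: "\<forall>i\<in>{1..s}. ?As (P i) = {X i}" and sh: "shortest_primary_decomposition R M N s P" for s P X
  proof -
    show "?As N = X ` {1..s}"
      using irr[OF _ X] shortest_imp_irredundant[OF assms(4,5) sh] sh
      by (simp add: shortest_primary_decomposition_def)
    show "inj_on X {1..s}"
      using shortest_imp_inj_on[OF assms(3) sh] X by blast
  qed
  \<comment> \<open>Being primary gives a prime for each component separately; finitely many choices
    assemble them into a function on the indices.\<close>
  have prime_ex: "\<exists>X. \<forall>i\<in>{1..s}. ?As (P i) = {X i}" if "primary_decomposition R M N s P" for s P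
    using primary_decompositionD(2)[OF that] unfolding primary_submodule_def by (intro bchoice) blast
  have iff: "shortest_primary_decomposition R M N r L \<longleftrightarrow> finite (?As N) \<and> r = card (?As N)"
    if dec: "primary_decomposition R M N r L" for r L
  proof
    assume sh: "shortest_primary_decomposition R M N r L"
    obtain X where X: "\<forall>i\<in>{1..r}. ?As (L i) = {X i}"
      using prime_ex[OF dec] by blast
    show "finite (?As N) \<and> r = card (?As N)"
      using short[OF X sh] by (simp add: card_image)
  next
    assume r: "finite (?As N) \<and> r = card (?As N)"
    \<comment> \<open>The associated left primes of M/N are among the at most t primes of any
      decomposition with t terms, so their number bounds every length from below.\<close>
    have "r \<le> t" if Q: "primary_decomposition R M N t Q" for t Q
    proof -
      obtain X where "\<forall>i\<in>{1..t}. ?As (Q i) = {X i}"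
        using prime_ex[OF Q] by blast
      from sub[OF Q this] have "r \<le> card (X ` {1..t})"
        using r by (simp add: card_mono)
      also have "\<dots> \<le> t"
        using card_image_le[of "{1..t}" X] by simp
      finally show ?thesis .
    qed
    then show "shortest_primary_decomposition R M N r L"
      using dec unfolding shortest_primary_decomposition_def by (meson not_le)
  qed
  show ?thesis
  proof (intro conjI allI impI; (elim conjE)?)
    show "\<exists>s P. primary_decomposition R M N s P"
      by (rule primary_decomposition_exists[OF assms(3-5)])
  next
    fix s P X
    assume dec: "primary_decomposition R M N s P" and X: "\<forall>i\<in>{1..s}. ?As (P i) = {X i}"
    then show un: "(\<Union>i\<in>{1..s}. ?As (P i)) = X ` {1..s}"
      by auto
    show "?As N \<subseteq> (\<Union>i\<in>{1..s}. ?As (P i))"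
      unfolding un by (rule sub[OF dec X])
    show "?As N = (\<Union>i\<in>{1..s}. ?As (P i))" if "irredundant_intersection M s P"
      unfolding un by (rule irr[OF dec X that])
    show "\<forall>Y\<in>?As N. \<exists>!i. i \<in> {1..s} \<and> Y = X i" if sh: "shortest_primary_decomposition R M N s P"
    proof
      fix Y assume "Y \<in> ?As N"
      then obtain i where i: "i \<in> {1..s}" "Y = X i"
        unfolding short(1)[OF X sh] by blast
      show "\<exists>!i. i \<in> {1..s} \<and> Y = X i"
      proof (rule ex1I[of _ i])
        fix j assume "j \<in> {1..s} \<and> Y = X j"
        then show "j = i"
          using i by (intro inj_onD[OF short(2)[OF X sh]]) auto
      qed (use i in blast)
    qed
  next
    fix r L assume "primary_decomposition R M N r L"
    then show "shortest_primary_decomposition R M N r L \<longleftrightarrow> finite (?As N) \<and> r = card (?As N)"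
      by (rule iff)
  qed
qed

end
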